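(* Let $\Phi$ be a Schur channel on $\mathrm{L}(\mathcal{H}_d)$. Then $$\frac{1}{2}D(\Phi,\Lambda_d)\ \le\ D\big(\Phi,\mathrm{Conv}(\mathbb{U}(\mathcal{H}_d))\big)\ \le\ D(\Phi,\Lambda_d),$$ where $\Lambda_d$ is the set of Schur channels on $\mathrm{L}(\mathcal{H}_d)$ that belong to $\mathrm{Conv}(\mathbb{U}(\mathcal{H}_d))$.
   Context: $\mathcal{H}_d$ denotes a $d$-dimensional complex Hilbert space with a fixed orthonormal basis; $\mathrm{L}(\mathcal{H})$ is the space of linear operators on $\mathcal{H}$. A Schur channel on $\mathrm{L}(\mathcal{H}_d)$ is a map $\Phi_S(X)=S\circ X$ (entrywise product in the fixed basis), where $S$ is a $d\times d$ positive semidefinite matrix with all diagonal entries equal to $1$; the set of Schur channels is denoted $\mathrm{S}(\mathcal{H}_d)$. $\mathbb{U}(\mathcal{H}_d)$ is the set of unitary channels $X\mapsto UXU^\dagger$ with $U$ unitary on $\mathcal{H}_d$, and $\mathrm{Conv}$ denotes convex hull. $\Lambda_d=\mathrm{S}(\mathcal{H}_d)\cap\mathrm{Conv}(\mathbb{U}(\mathcal{H}_d))$; equivalently, it is the set of maps $X\mapsto\sum_k p_kU_kXU_k^\dagger$ with $\{p_k\}$ a finite probability distribution and $U_k$ diagonal unitary matrices. For a linear map $\Phi$ on $\mathrm{L}(\mathcal{H})$, $\|\Phi\|_1=\sup_{\|X\|_1\le 1}\|\Phi(X)\|_1$ with $\|X\|_1=\mathrm{Tr}|X|$, and the diamond norm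 is $\|\Phi\|_\diamond=\sup_{n\ge1}\|\Phi\otimes \mathrm{id}_{\mathrm{L}(\mathbb{C}^n)}\|_1$. $D(\Phi,\Psi)=\|\Phi-\Psi\|_\diamond$, and $D(\Phi,\mathcal{S})=\inf_{\Psi\in\mathcal{S}}D(\Phi,\Psi)$ for a set $\mathcal{S}$ of channels. *)

theory Defs
  imports
    "Jordan_Normal_Form.Matrix"
    "Jordan_Normal_Form.Schur_Decomposition"
    "HOL-Library.FuncSet"
    "HOL-Library.Extended_Real"
begin

text \<open>
  Operators on a \<open>d\<close>-dimensional complex Hilbert space with a fixed orthonormal basis are the
  matrices in \<open>carrier_mat d d\<close>.  A map between operators is a function on matrices; channels
  are taken extensional (\<open>undefined\<close> outside \<open>carrier_mat d d\<close>), so that equality of functions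
  is equality of maps on operators and sets of channels can be intersected.
\<close>

type_synonym op_map = "complex mat \<Rightarrow> complex mat"

subsection \<open>Trace norm\<close>

text \<open>Over the complex numbers \<open>0 \<le> z\<close> says that \<open>z\<close> is real and nonnegative, so
  \<open>psd\<close> entails that the matrix is Hermitian.\<close>

definition psd :: "nat \<Rightarrow> complex mat \<Rightarrow> bool" where
  "psd n A \<longleftrightarrow> A \<in> carrier_mat n n \<and> (\<forall>v \<in> carrier_vec n. 0 \<le> (A *\<^sub>v v) \<bullet>c v)"

text \<open>The absolute value is the unique positive semidefinite square root of \<open>X\<^sup>\<dagger> X\<close>.\<close>

definition mat_abs :: "complex mat \<Rightarrow> complex mat" where
  "mat_abs X = (THE P. psd (dim_col X) P \<and> P * P = mat_adjoint X * X)"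

definition mat_trace :: "complex mat \<Rightarrow> complex" where
  "mat_trace A = (\<Sum>i<dim_row A. A $$ (i, i))"

definition trace_norm :: "complex mat \<Rightarrow> real" where
  "trace_norm X = Re (mat_trace (mat_abs X))"

subsection \<open>Diamond norm\<close>

text \<open>Suprema and infima are taken in the extended reals, where they need no side conditions.\<close>

definition induced_trace_norm :: "nat \<Rightarrow> op_map \<Rightarrow> ereal" where
  "induced_trace_norm N \<Phi> =
     (SUP X \<in> {X \<in> carrier_mat N N. trace_norm X \<le> 1}. ereal (trace_norm (\<Phi> X)))"

text \<open>The basis vector \<open>e\<^sub>i \<otimes> e\<^sub>a\<close> of the tensor product of a space with an \<open>n\<close>-dimensional one
  has index \<open>i * n + a\<close>.\<close>

definition kron :: "complex mat \<Rightarrow> complex mat \<Rightarrow> complex mat" where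
  "kron A B = mat (dim_row A * dim_row B) (dim_col A * dim_col B)
     (\<lambda>(r, c). A $$ (r div dim_row B, c div dim_col B) * B $$ (r mod dim_row B, c mod dim_col B))"

text \<open>An operator on the tensor product is \<open>\<Sum>\<^sub>a\<^sub>b X\<^sub>a\<^sub>b \<otimes> E\<^sub>a\<^sub>b\<close> with \<open>E\<^sub>a\<^sub>b\<close> the matrix units of size \<open>n\<close>;
  \<open>\<Phi> \<otimes> id\<close> applies \<open>\<Phi>\<close> to each coefficient \<open>X\<^sub>a\<^sub>b\<close>.\<close>

definition tensor_coeff :: "nat \<Rightarrow> nat \<Rightarrow> complex mat \<Rightarrow> nat \<Rightarrow> nat \<Rightarrow> complex mat" where
  "tensor_coeff d n X a b = mat d d (\<lambda>(i, j). X $$ (i * n + a, j * n + b))"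

definition tensor_id :: "nat \<Rightarrow> nat \<Rightarrow> op_map \<Rightarrow> op_map" where
  "tensor_id d n \<Phi> X = mat (d * n) (d * n)
     (\<lambda>(r, c). \<Phi> (tensor_coeff d n X (r mod n) (c mod n)) $$ (r div n, c div n))"

lemma tensor_id_kron:
  assumes maps: "\<And>A. A \<in> carrier_mat d d \<Longrightarrow> \<Phi> A \<in> carrier_mat d d"
    and scale: "\<And>z A. A \<in> carrier_mat d d \<Longrightarrow> \<Phi> (z \<cdot>\<^sub>m A) = z \<cdot>\<^sub>m \<Phi> A"
    and A: "A \<in> carrier_mat d d" and B: "B \<in> carrier_mat n n"
  shows "tensor_id d n \<Phi> (kron A B) = kron (\<Phi> A) B"
proof (rule eq_matI)
  have \<Phi>A: "\<Phi> A \<in> carrier_mat d d" using maps A by blast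
  fix r c assume "r < dim_row (kron (\<Phi> A) B)" "c < dim_col (kron (\<Phi> A) B)"
  then have r: "r < d * n" and c: "c < d * n" using \<Phi>A B by (auto simp: kron_def)
  then have n: "0 < n" by (cases n) auto
  have bnd: "i * n + a < d * n" if "i < d" "a < n" for i a
  proof -
    have "i * n + a < Suc i * n" using that by simp
    also have "\<dots> \<le> d * n" using that by (intro mult_right_mono) auto
    finally show ?thesis .
  qed
  have "tensor_coeff d n (kron A B) (r mod n) (c mod n) = B $$ (r mod n, c mod n) \<cdot>\<^sub>m A"
    using A B n bnd by (intro eq_matI) (auto simp: tensor_coeff_def kron_def)
  moreover have "r div n < d" "c div n < d"
    using r c n by (simp_all add: less_mult_imp_div_less)
  ultimately show "tensor_id d n \<Phi> (kron A B) $$ (r, c) = kron (\<Phi> A) B $$ (r, c)"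
    using r c \<Phi>A A B by (simp add: tensor_id_def kron_def scale mult.commute)
qed (use maps[OF A] B in \<open>auto simp: tensor_id_def kron_def\<close>)

definition diamond_norm :: "nat \<Rightarrow> op_map \<Rightarrow> ereal" where
  "diamond_norm d \<Phi> = (SUP n \<in> {1..}. induced_trace_norm (d * n) (tensor_id d n \<Phi>))"

definition channel_dist :: "nat \<Rightarrow> op_map \<Rightarrow> op_map \<Rightarrow> ereal" where
  "channel_dist d \<Phi> \<Psi> = diamond_norm d (\<lambda>X. \<Phi> X - \<Psi> X)"

definition set_dist :: "nat \<Rightarrow> op_map \<Rightarrow> op_map set \<Rightarrow> ereal" where
  "set_dist d \<Phi> T = (INF \<Psi> \<in> T. channel_dist d \<Phi> \<Psi>)"

subsection \<open>Classes of channels\<close>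

definition schur_map :: "nat \<Rightarrow> complex mat \<Rightarrow> op_map" where
  "schur_map d S = (\<lambda>X \<in> carrier_mat d d. mat d d (\<lambda>(i, j). S $$ (i, j) * X $$ (i, j)))"

definition schur_channels :: "nat \<Rightarrow> op_map set" where
  "schur_channels d = {schur_map d S | S. psd d S \<and> (\<forall>i<d. S $$ (i, i) = 1)}"

definition unitary_mats :: "nat \<Rightarrow> complex mat set" where
  "unitary_mats d = {U \<in> carrier_mat d d. U * mat_adjoint U = 1\<^sub>m d \<and> mat_adjoint U * U = 1\<^sub>m d}"

definition unitary_channels :: "nat \<Rightarrow> op_map set" where
  "unitary_channels d =
     {(\<lambda>X \<in> carrier_mat d d. U * X * mat_adjoint U) | U. U \<in> unitary_mats d}"

text \<open>The library's \<open>convex hull\<close> needs a real vector space type, which \<^typ>\<open>complex mat\<close> (with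
  matrices of all sizes) does not provide; the convex combinations are therefore written out.\<close>

definition conv_channels :: "nat \<Rightarrow> op_map set \<Rightarrow> op_map set" where
  "conv_channels d T =
     {(\<lambda>X \<in> carrier_mat d d.
         mat d d (\<lambda>(i, j). \<Sum>k<m. complex_of_real (p k) * F k X $$ (i, j))) |
       (m :: nat) (p :: nat \<Rightarrow> real) F.
         (\<forall>k<m. 0 \<le> p k \<and> F k \<in> T) \<and> (\<Sum>k<m. p k) = 1}"

definition schur_mixed_unitary :: "nat \<Rightarrow> op_map set" where
  "schur_mixed_unitary d = schur_channels d \<inter> conv_channels d (unitary_channels d)"

end

theory Submission
  imports Defs "Jordan_Normal_Form.Char_Poly" "HOL-Analysis.L2_Norm"
begin

text \<open>
  Let \<open>\<Psi> = \<Sum>\<^sub>k p\<^sub>k U\<^sub>k \<cdot> U\<^sub>k\<^sup>\<dagger>\<close> be mixed unitary.  The diagonals of the \<open>U\<^sub>k\<close> have entries \<open>z\<^sub>k\<^sub>i\<close> in the unit disc, so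
  replacing \<open>U\<^sub>k\<close> by diagonal unitaries with independent random phases of mean \<open>z\<^sub>k\<^sub>i\<close> gives an element
  \<open>\<Lambda>\<close> of \<open>\<Lambda>\<^sub>d\<close> with Schur matrix \<open>\<Sum>\<^sub>k p\<^sub>k z\<^sub>k\<^sub>i z\<^sub>k\<^sub>j\<^sup>*\<close> off the diagonal.  Up to the diagonal, \<open>\<Phi> - \<Lambda>\<close> is
  therefore the compression of \<open>\<Phi> - \<Psi>\<close> to a Schur multiplier, which does not increase the diamond norm.
  Since \<open>\<Phi> - \<Lambda>\<close> vanishes on the diagonal, it is that compression minus its pinching, and pinchings do
  not increase the trace norm; this gives the factor \<open>2\<close>.

  The trace norm is handled through its dual description as the maximum of \<open>|Tr (W X)|\<close> over
  contractions \<open>W\<close>.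
\<close>

subsection \<open>The spectral theorem for Hermitian matrices\<close>

text \<open>Vectors and matrices are encoded as functions of which only the values at indices below
  \<open>n\<close> count, so that sums, scalings and families of vectors need no carrier
  conditions.\<close>

definition inner_n :: "nat \<Rightarrow> (nat \<Rightarrow> complex) \<Rightarrow> (nat \<Rightarrow> complex) \<Rightarrow> complex" where
  "inner_n n u v = (\<Sum>i<n. cnj (u i) * v i)"

definition app_n :: "nat \<Rightarrow> (nat \<Rightarrow> nat \<Rightarrow> complex) \<Rightarrow> (nat \<Rightarrow> complex) \<Rightarrow> nat \<Rightarrow> complex" where
  "app_n n a v i = (\<Sum>j<n. a i j * v j)"

definition hermitian_n :: "nat \<Rightarrow> (nat \<Rightarrow> nat \<Rightarrow> complex) \<Rightarrow> bool" where
  "hermitian_n n a \<longleftrightarrow> (\<forall>i<n. \<forall>j<n. a j i = cnj (a i j))"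

definition orthonormal_n :: "nat \<Rightarrow> nat \<Rightarrow> (nat \<Rightarrow> nat \<Rightarrow> complex) \<Rightarrow> bool" where
  "orthonormal_n n m q \<longleftrightarrow> (\<forall>k<m. \<forall>l<m. inner_n n (q k) (q l) = of_bool (k = l))"

text \<open>This is the matrix \<Sum> c y q\<dagger> over \<open>k < m\<close>, the common shape of
  spectral and singular value decompositions.\<close>

definition dyad_sum :: "nat \<Rightarrow> (nat \<Rightarrow> real) \<Rightarrow> (nat \<Rightarrow> nat \<Rightarrow> complex) \<Rightarrow> (nat \<Rightarrow> nat \<Rightarrow> complex)
    \<Rightarrow> nat \<Rightarrow> nat \<Rightarrow> complex" where
  "dyad_sum m c y q i j = (\<Sum>k<m. of_real (c k) * y k i * cnj (q k j))"

definition norm_n :: "nat \<Rightarrow> (nat \<Rightarrow> complex) \<Rightarrow> real" where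
  "norm_n n v = L2_set (\<lambda>i. cmod (v i)) {..<n}"

lemma inner_n_cong:
  assumes "\<And>i. i < n \<Longrightarrow> u i = u' i" "\<And>i. i < n \<Longrightarrow> v i = v' i"
  shows "inner_n n u v = inner_n n u' v'"
  unfolding inner_n_def using assms by (intro sum.cong) auto

lemma inner_n_cnj: "cnj (inner_n n u v) = inner_n n v u"
  by (simp add: inner_n_def mult.commute)

lemma inner_n_scale_right: "inner_n n u (\<lambda>i. c * v i) = c * inner_n n u v"
  by (simp add: inner_n_def sum_distrib_left mult_ac)

lemma inner_n_scale_left: "inner_n n (\<lambda>i. c * u i) v = cnj c * inner_n n u v"
  by (simp add: inner_n_def sum_distrib_left mult_ac)

lemma inner_n_add_right: "inner_n n u (\<lambda>i. v i + w i) = inner_n n u v + inner_n n u w"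
  by (simp add: inner_n_def sum.distrib algebra_simps)

lemma inner_n_diff_right: "inner_n n u (\<lambda>i. v i - w i) = inner_n n u v - inner_n n u w"
  by (simp add: inner_n_def sum_subtractf algebra_simps)

lemma inner_n_sum_right: "inner_n n u (\<lambda>i. \<Sum>k\<in>K. c k * q k i) = (\<Sum>k\<in>K. c k * inner_n n u (q k))"
  unfolding inner_n_def sum_distrib_left by (subst sum.swap) (simp add: mult_ac)

lemma norm_n_nonneg: "0 \<le> norm_n n v"
  by (simp add: norm_n_def)

lemma norm_n_square: "(norm_n n v)\<^sup>2 = (\<Sum>i<n. (cmod (v i))\<^sup>2)"
  by (simp add: norm_n_def L2_set_def sum_nonneg)

lemma inner_n_self: "inner_n n v v = of_real ((norm_n n v)\<^sup>2)"
  unfolding norm_n_square inner_n_def of_real_sum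
  by (intro sum.cong refl) (simp add: complex_norm_square mult.commute del: of_real_power)

lemma inner_n_self_eq_0_iff: "inner_n n v v = 0 \<longleftrightarrow> (\<forall>i<n. v i = 0)"
  unfolding inner_n_self of_real_eq_0_iff power_eq_0_iff norm_n_def
  by (subst L2_set_eq_0_iff) auto

lemma inner_n_app_n: "inner_n n u (app_n n a v) = (\<Sum>i<n. \<Sum>j<n. cnj (u i) * a i j * v j)"
  by (simp add: inner_n_def app_n_def sum_distrib_left mult.assoc)

lemma hermitian_nD: "hermitian_n n a \<Longrightarrow> i < n \<Longrightarrow> j < n \<Longrightarrow> a j i = cnj (a i j)"
  unfolding hermitian_n_def by blast

lemma hermitian_n_inner:
  assumes "hermitian_n n a"
  shows "inner_n n u (app_n n a v) = inner_n n (app_n n a u) v"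
proof -
  have "inner_n n (app_n n a u) v = (\<Sum>j<n. \<Sum>i<n. cnj (u i) * cnj (a j i) * v j)"
    unfolding inner_n_def app_n_def cnj_sum sum_distrib_right complex_cnj_mult
    by (simp only: mult.commute)
  also have "\<dots> = (\<Sum>j<n. \<Sum>i<n. cnj (u i) * a i j * v j)"
  proof (intro sum.cong refl)
    fix i j assume "j \<in> {..<n}" "i \<in> {..<n}"
    then have "cnj (a j i) = a i j" using hermitian_nD[OF assms, of j i] by simp
    then show "cnj (u i) * cnj (a j i) * v j = cnj (u i) * a i j * v j" by simp
  qed
  also have "\<dots> = inner_n n u (app_n n a v)"
    unfolding inner_n_app_n by (rule sum.swap)
  finally show ?thesis by simp
qed

text \<open>The residual \<open>r\<close> of \<open>v\<close> after subtracting its components along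
  the \<open>q k\<close> is orthogonal to all of them, so its squared norm is the difference of the
  two sides and hence nonnegative.\<close>

lemma bessel:
  assumes "orthonormal_n n m q"
  shows "(\<Sum>k<m. (cmod (inner_n n (q k) v))\<^sup>2) \<le> (norm_n n v)\<^sup>2"
proof -
  define a where "a k = inner_n n (q k) v" for k
  define r where "r i = v i - (\<Sum>k<m. a k * q k i)" for i
  have qr: "inner_n n (q l) r = 0" if "l < m" for l
  proof -
    have "inner_n n (q l) r = a l - (\<Sum>k<m. a k * inner_n n (q l) (q k))"
      unfolding r_def inner_n_diff_right inner_n_sum_right a_def ..
    also have "(\<Sum>k<m. a k * inner_n n (q l) (q k)) = (\<Sum>k<m. if l = k then a k else 0)"
      using assms that by (intro sum.cong refl) (auto simp: orthonormal_n_def)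
    also have "\<dots> = a l" using that by simp
    finally show ?thesis by simp
  qed
  have "inner_n n r r = inner_n n r v - (\<Sum>k<m. a k * inner_n n r (q k))"
  proof -
    have "inner_n n r r = inner_n n r (\<lambda>i. v i - (\<Sum>k<m. a k * q k i))"
      by (intro inner_n_cong) (simp_all only: r_def)
    then show ?thesis unfolding inner_n_diff_right inner_n_sum_right .
  qed
  also have "(\<Sum>k<m. a k * inner_n n r (q k)) = 0"
    using qr by (intro sum.neutral ballI) (metis inner_n_cnj complex_cnj_zero lessThan_iff mult_zero_right)
  also have "inner_n n r v = cnj (inner_n n v r)"
    by (simp add: inner_n_cnj)
  also have "inner_n n v r = inner_n n v v - (\<Sum>k<m. a k * inner_n n v (q k))"
    unfolding r_def inner_n_diff_right inner_n_sum_right ..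
  also have "(\<Sum>k<m. a k * inner_n n v (q k)) = (\<Sum>k<m. of_real ((cmod (a k))\<^sup>2))"
    by (intro sum.cong refl) (metis a_def inner_n_cnj complex_norm_square)
  finally have "complex_of_real ((norm_n n r)\<^sup>2)
      = of_real ((norm_n n v)\<^sup>2 - (\<Sum>k<m. (cmod (a k))\<^sup>2))"
    unfolding inner_n_self by simp
  then have "(norm_n n r)\<^sup>2 = (norm_n n v)\<^sup>2 - (\<Sum>k<m. (cmod (a k))\<^sup>2)"
    using of_real_eq_iff by blast
  then show ?thesis
    using zero_le_power2[of "norm_n n r"] unfolding a_def by linarith
qed

text \<open>The squared moduli of all entries of the \<open>q k\<close> add up to \<open>m\<close>.
  Grouped by coordinate \<open>i\<close>, they are the Bessel sum of a basis vector, so each of the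
  \<open>n\<close> groups contributes at most 1.\<close>

lemma orthonormal_n_card:
  assumes "orthonormal_n n m q"
  shows "m \<le> n"
proof -
  have "real m = (\<Sum>k<m. (norm_n n (q k))\<^sup>2)"
  proof -
    have "(norm_n n (q k))\<^sup>2 = 1" if "k < m" for k
      using assms that inner_n_self[of n "q k"] unfolding orthonormal_n_def
      by (metis (full_types) of_bool_eq(2) of_real_eq_1_iff)
    then show ?thesis by simp
  qed
  also have "\<dots> = (\<Sum>i<n. \<Sum>k<m. (cmod (q k i))\<^sup>2)"
    unfolding norm_n_square by (rule sum.swap)
  also have "\<dots> \<le> (\<Sum>i<n. 1)"
  proof (rule sum_mono)
    fix i assume i: "i \<in> {..<n}"
    define e where "e j = (of_bool (j = i) :: complex)" for j
    have "inner_n n (q k) e = (\<Sum>j<n. if j = i then cnj (q k j) else 0)" for k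
      unfolding inner_n_def e_def by (intro sum.cong) auto
    then have "inner_n n (q k) e = cnj (q k i)" for k
      using i by simp
    moreover have "(norm_n n e)\<^sup>2 = (\<Sum>j<n. if j = i then 1 else 0)"
      unfolding norm_n_square e_def by (intro sum.cong) auto
    then have "(norm_n n e)\<^sup>2 = 1" using i by simp
    ultimately show "(\<Sum>k<m. (cmod (q k i))\<^sup>2) \<le> 1"
      using bessel[OF assms, of e] by simp
  qed
  finally show ?thesis by simp
qed

lemma hermitian_n_square_kernel:
  assumes "hermitian_n n b" "\<And>i. i < n \<Longrightarrow> app_n n b (app_n n b x) i = 0" "i < n"
  shows "app_n n b x i = 0"
proof -
  have "inner_n n (app_n n b x) (app_n n b x) = inner_n n x (app_n n b (app_n n b x))"
    using hermitian_n_inner[OF assms(1)] by simp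
  also have "\<dots> = 0" unfolding inner_n_def using assms(2) by simp
  finally show ?thesis using assms(3) inner_n_self_eq_0_iff by blast
qed

lemma mult_mat_vec_mat:
  assumes "v \<in> carrier_vec n"
  shows "mat n n (\<lambda>(i, j). b i j) *\<^sub>v v = vec n (app_n n b (\<lambda>j. v $ j))"
  using assms by (intro eq_vecI) (auto simp: scalar_prod_def app_n_def atLeast0LessThan)

text \<open>If all eigenvalues vanish, a triangular form \<open>J\<close> is strictly triangular, and its first
  nonzero column gives a vector with \<open>J\<^sup>2 x = 0 \<noteq> J x\<close>, impossible for Hermitian matrices.\<close>

lemma hermitian_n_nonzero_eigenvalue:
  assumes herm: "hermitian_n n b" and nz: "i0 < n" "j0 < n" "b i0 j0 \<noteq> 0"
  shows "\<exists>\<mu> v. \<mu> \<noteq> 0 \<and> inner_n n v v = 1 \<and> (\<forall>i<n. app_n n b v i = \<mu> * v i)"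
proof -
  define B where "B = mat n n (\<lambda>(i, j). b i j)"
  have B: "B \<in> carrier_mat n n" by (simp add: B_def)
  have Bv: "B *\<^sub>v v = vec n (app_n n b (\<lambda>j. v $ j))" if "v \<in> carrier_vec n" for v
    unfolding B_def using mult_mat_vec_mat[OF that] .
  obtain as where "char_poly B = (\<Prod>a\<leftarrow>as. [:- a, 1:])"
    using char_poly_factorized[OF B] by blast
  then obtain J where J: "J \<in> carrier_mat n n" "upper_triangular J" "similar_mat B J"
    using schur_decomposition_exists[OF B] by blast
  obtain P Q where "similar_mat_wit B J P Q"
    using J(3) unfolding similar_mat_def by blast
  from similar_mat_witD2[OF B this]
  have PQ: "P \<in> carrier_mat n n" "Q \<in> carrier_mat n n" "Q * P = 1\<^sub>m n" "B = P * J * Q" by auto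
  have "\<exists>k<n. J $$ (k, k) \<noteq> 0"
  proof (rule ccontr)
    assume "\<not> (\<exists>k<n. J $$ (k, k) \<noteq> 0)"
    then have J0: "J $$ (r, c) = 0" if "c \<le> r" "r < n" for r c
      using that J(1,2) by (cases "c = r") (auto dest: upper_triangularD)
    \<comment> \<open>The first nonzero column exists because \<open>J = 0\<close> would force
      \<open>B = 0\<close>, against the nonzero entry of \<open>b\<close>.\<close>
    define c where "c = (LEAST c. c < n \<and> (\<exists>r<n. J $$ (r, c) \<noteq> 0))"
    have ex: "\<exists>c. c < n \<and> (\<exists>r<n. J $$ (r, c) \<noteq> 0)"
    proof (rule ccontr)
      assume "\<nexists>c. c < n \<and> (\<exists>r<n. J $$ (r, c) \<noteq> 0)"
      then have "J = 0\<^sub>m n n" using J(1) by (intro eq_matI) auto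
      then have "B = 0\<^sub>m n n" using PQ by simp
      then have "B $$ (i0, j0) = 0" using nz by simp
      then show False using nz by (simp add: B_def)
    qed
    have c: "c < n" "\<exists>r<n. J $$ (r, c) \<noteq> 0"
      using LeastI_ex[OF ex] unfolding c_def by auto
    have least: "J $$ (r, k) = 0" if "k < c" "r < n" for r k
      using not_less_Least[of k "\<lambda>c. c < n \<and> (\<exists>r<n. J $$ (r, c) \<noteq> 0)"] that c(1)
      unfolding c_def by auto
    define w where "w = col J c"
    have w: "w \<in> carrier_vec n" using J(1) by (auto simp: w_def)
    have w0: "w \<noteq> 0\<^sub>v n"
      using c J(1) unfolding w_def by (metis carrier_matD index_col index_zero_vec(1))
    \<comment> \<open>Every product in row \<open>r\<close> vanishes: for \<open>k < c\<close>
      column \<open>k\<close> of \<open>J\<close> is zero by minimality, and for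
      \<open>k \<ge> c\<close> the entry \<open>w $ k\<close> lies on or below the diagonal.\<close>
    have Jw: "J *\<^sub>v w = 0\<^sub>v n"
    proof (rule eq_vecI)
      fix r assume r: "r < dim_vec (0\<^sub>v n)"
      have "J $$ (r, k) * w $ k = 0" if "k < n" for k
        using least[of k r] J0[of c k] r that c(1) J(1) unfolding w_def
        by (cases "k < c") auto
      then show "(J *\<^sub>v w) $ r = 0\<^sub>v n $ r"
        using r J(1) w by (auto simp: scalar_prod_def intro!: sum.neutral)
    qed (use J(1) in auto)
    have BP: "B *\<^sub>v (P *\<^sub>v u) = P *\<^sub>v (J *\<^sub>v u)" if "u \<in> carrier_vec n" for u
    proof -
      have "B *\<^sub>v (P *\<^sub>v u) = (P * J * Q * P) *\<^sub>v u"
        unfolding PQ(4) using PQ J(1) that by (simp add: assoc_mult_mat_vec[of _ n n _ n])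
      also have "P * J * Q * P = P * J"
        using PQ J(1) by (simp add: assoc_mult_mat[of _ n n _ n _ n])
      finally show ?thesis using PQ J(1) that by (simp add: assoc_mult_mat_vec[of _ n n _ n])
    qed
    \<comment> \<open>Transporting the basis vector back through the similarity gives
      \<open>B x = P w\<close> and \<open>B (B x) = P (J w) = 0\<close>. The kernel lemma then
      yields \<open>P w = 0\<close>, and \<open>w = 0\<close> since \<open>P\<close> is
      invertible.\<close>
    define x where "x = P *\<^sub>v unit_vec n c"
    have x: "x \<in> carrier_vec n" using PQ by (simp add: x_def)
    have "J *\<^sub>v unit_vec n c = w"
      using J(1) c(1) unfolding w_def by (intro eq_vecI) auto
    then have Bx: "B *\<^sub>v x = P *\<^sub>v w" unfolding x_def using BP[of "unit_vec n c"] by simp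
    have BBx: "B *\<^sub>v (B *\<^sub>v x) = 0\<^sub>v n"
      unfolding Bx BP[OF w] Jw using PQ(1) by (intro eq_vecI) auto
    have "app_n n b (\<lambda>j. x $ j) i = 0" if "i < n" for i
    proof (rule hermitian_n_square_kernel[OF herm _ that])
      fix i assume i: "i < n"
      have "(B *\<^sub>v (B *\<^sub>v x)) $ i = app_n n b (\<lambda>j. (B *\<^sub>v x) $ j) i"
        using i B x by (subst Bv) auto
      also have "\<dots> = app_n n b (app_n n b (\<lambda>j. x $ j)) i"
        using Bv[OF x] unfolding app_n_def[of n b _ i] by (intro sum.cong) auto
      finally show "app_n n b (app_n n b (\<lambda>j. x $ j)) i = 0"
        using BBx i by simp
    qed
    then have "B *\<^sub>v x = 0\<^sub>v n" using Bv[OF x] by (intro eq_vecI) auto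
    then have "Q *\<^sub>v (P *\<^sub>v w) = 0\<^sub>v n"
      unfolding Bx[symmetric] using PQ(2) by (intro eq_vecI) auto
    moreover have "Q *\<^sub>v (P *\<^sub>v w) = w"
      using PQ w by (simp flip: assoc_mult_mat_vec[of _ n n _ n])
    ultimately show False using w0 by simp
  qed
  then obtain k where k: "k < n" "J $$ (k, k) \<noteq> 0" by blast
  define \<mu> where "\<mu> = J $$ (k, k)"
  have "poly (char_poly J) \<mu> = 0"
  proof -
    have "\<mu> \<in> set (diag_mat J)" using k J(1) by (auto simp: \<mu>_def diag_mat_def)
    then have "poly (\<Prod>a\<leftarrow>diag_mat J. [:- a, 1:]) \<mu> = 0"
      by (rule linear_poly_root)
    then show ?thesis using char_poly_upper_triangular[OF J(1,2)] by simp
  qed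
  then have "eigenvalue B \<mu>"
    using eigenvalue_root_char_poly[OF B] char_poly_similar[OF J(3)] by simp
  then obtain v where v: "v \<in> carrier_vec n" "v \<noteq> 0\<^sub>v n" "B *\<^sub>v v = \<mu> \<cdot>\<^sub>v v"
    using B unfolding eigenvalue_def eigenvector_def by auto
  define x where "x j = v $ j" for j
  define t where "t = norm_n n x"
  have "inner_n n x x \<noteq> 0"
    unfolding inner_n_self_eq_0_iff using v(1,2) unfolding x_def
    by (metis carrier_vecD eq_vecI index_zero_vec)
  then have t: "t \<noteq> 0" unfolding inner_n_self t_def by simp
  have bx: "app_n n b x i = \<mu> * x i" if "i < n" for i
    using v(1,3) Bv[OF v(1)] that unfolding x_def
    by (metis carrier_vecD index_smult_vec(1) index_vec)
  define y where "y = (\<lambda>j. of_real (1 / t) * x j)"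
  have "inner_n n y y = 1"
    unfolding y_def inner_n_scale_right inner_n_scale_left inner_n_self[of n x]
    using t by (simp add: t_def[symmetric] power2_eq_square)
  moreover have "app_n n b y i = \<mu> * y i" if "i < n" for i
  proof -
    have "app_n n b y i = of_real (1 / t) * app_n n b x i"
      by (simp add: app_n_def y_def sum_distrib_left mult_ac)
    then show ?thesis using bx[OF that] by (simp add: y_def)
  qed
  moreover have "\<mu> \<noteq> 0" using k by (simp add: \<mu>_def)
  ultimately show ?thesis by blast
qed

lemma hermitian_n_eigenvalue_real:
  assumes "hermitian_n n b" "inner_n n v v = 1" "\<And>i. i < n \<Longrightarrow> app_n n b v i = \<mu> * v i"
  shows "\<mu> = of_real (Re \<mu>)"
proof -
  have "inner_n n v (app_n n b v) = \<mu>"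
    using inner_n_cong[of n v v "app_n n b v" "\<lambda>i. \<mu> * v i"] assms(2,3)
    by (simp add: inner_n_scale_right)
  moreover have "inner_n n (app_n n b v) v = cnj \<mu>"
    using inner_n_cong[of n "app_n n b v" "\<lambda>i. \<mu> * v i" v v] assms(2,3)
    by (simp add: inner_n_scale_left)
  ultimately have "\<mu> = cnj \<mu>" using hermitian_n_inner[OF assms(1), of v v] by simp
  then show ?thesis by (metis Reals_cnj_iff of_real_Re)
qed

text \<open>Deflation: a nonzero eigenvector of \<open>a - \<Sum> c\<^sub>k q\<^sub>k q\<^sub>k\<^sup>\<dagger>\<close> is orthogonal to all \<open>q\<^sub>k\<close>; the process
  stops because there are at most \<open>n\<close> orthonormal vectors.\<close>

theorem spectral_decomposition:
  assumes herm: "hermitian_n n a"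
  obtains m c q where "orthonormal_n n m q" "\<And>k. k < m \<Longrightarrow> c k \<noteq> (0::real)"
    "\<And>i j. i < n \<Longrightarrow> j < n \<Longrightarrow> a i j = dyad_sum m c q q i j"
proof (rule ccontr)
  \<comment> \<open>If the deflation never ended in a decomposition, it would produce orthonormal
    eigenvectors in any number \<open>m\<close>; \<open>m = n + 1\<close> is already too
    many.\<close>
  assume none: "\<not> thesis"
  have "\<exists>c q. orthonormal_n n m q \<and> (\<forall>k<m. c k \<noteq> (0::real))
      \<and> (\<forall>k<m. \<forall>i<n. app_n n a (q k) i = of_real (c k) * q k i)" for m
  proof (induction m)
    case 0
    show ?case by (simp add: orthonormal_n_def)
  next
    case (Suc m)
    then obtain c q where q: "orthonormal_n n m q" and c: "\<And>k. k < m \<Longrightarrow> c k \<noteq> (0::real)"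
      and ev: "\<And>k i. k < m \<Longrightarrow> i < n \<Longrightarrow> app_n n a (q k) i = of_real (c k) * q k i" by blast
    define b where "b i j = a i j - (\<Sum>k<m. of_real (c k) * q k i * cnj (q k j))" for i j
    have hb: "hermitian_n n b"
      unfolding hermitian_n_def
    proof (intro allI impI)
      fix i j assume "i < n" "j < n"
      then have "a j i = cnj (a i j)" using herm unfolding hermitian_n_def by blast
      then show "b j i = cnj (b i j)" unfolding b_def by (simp add: mult_ac)
    qed
    have app_b: "app_n n b v i = app_n n a v i - (\<Sum>k<m. of_real (c k) * q k i * inner_n n (q k) v)" for v i
    proof -
      have "app_n n b v i = app_n n a v i
          - (\<Sum>j<n. \<Sum>k<m. of_real (c k) * q k i * (cnj (q k j) * v j))"
        unfolding app_n_def b_def by (simp add: algebra_simps sum_subtractf sum_distrib_left)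
      also have "(\<Sum>j<n. \<Sum>k<m. of_real (c k) * q k i * (cnj (q k j) * v j))
          = (\<Sum>k<m. of_real (c k) * q k i * inner_n n (q k) v)"
        unfolding inner_n_def sum_distrib_left by (rule sum.swap)
      finally show ?thesis .
    qed
    have bq: "app_n n b (q k) i = 0" if "k < m" "i < n" for k i
    proof -
      have "(\<Sum>l<m. of_real (c l) * q l i * inner_n n (q l) (q k))
          = (\<Sum>l<m. if l = k then of_real (c l) * q l i else 0)"
        using q that by (intro sum.cong refl) (auto simp: orthonormal_n_def)
      also have "\<dots> = of_real (c k) * q k i" using that by simp
      finally show ?thesis unfolding app_b ev[OF that] by simp
    qed
    \<comment> \<open>A vanishing remainder \<open>b\<close> would make the vectors found so far a
      decomposition of \<open>a\<close>.\<close>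
    have "\<exists>i<n. \<exists>j<n. b i j \<noteq> 0"
    proof (rule ccontr)
      assume "\<not> ?thesis"
      then have expand: "a i j = (\<Sum>k<m. of_real (c k) * q k i * cnj (q k j))"
        if "i < n" "j < n" for i j
        using that unfolding b_def by simp
      have thesis by (rule that[OF q c]) (simp_all add: expand dyad_sum_def)
      then show False using none by simp
    qed
    then obtain \<mu> v where v: "\<mu> \<noteq> 0" "inner_n n v v = 1" "\<And>i. i < n \<Longrightarrow> app_n n b v i = \<mu> * v i"
      using hermitian_n_nonzero_eigenvalue[OF hb] by blast
    have real: "\<mu> = of_real (Re \<mu>)" by (rule hermitian_n_eigenvalue_real[OF hb v(2,3)])
    \<comment> \<open>Since \<open>b\<close> is Hermitian and annihilates \<open>q k\<close>, the
      number \<mu> times the inner product is zero, while \<mu> is not.\<close>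
    have qv: "inner_n n (q k) v = 0" if "k < m" for k
    proof -
      have "\<mu> * inner_n n (q k) v = inner_n n (q k) (app_n n b v)"
        using inner_n_cong[of n "q k" "q k" "app_n n b v" "\<lambda>i. \<mu> * v i"] v(3)
        by (simp add: inner_n_scale_right)
      also have "\<dots> = inner_n n (app_n n b (q k)) v" by (rule hermitian_n_inner[OF hb])
      also have "\<dots> = 0" unfolding inner_n_def using bq[OF that] by simp
      finally show ?thesis using v(1) by simp
    qed
    then have vq: "inner_n n v (q k) = 0" if "k < m" for k
      using that by (metis complex_cnj_zero inner_n_cnj)
    define q' where "q' = q(m := v)"
    define c' where "c' = c(m := Re \<mu>)"
    have "orthonormal_n n (Suc m) q'"
      using q qv vq v(2) unfolding orthonormal_n_def q'_def by (auto simp: less_Suc_eq)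
    moreover have "\<forall>k<Suc m. c' k \<noteq> 0"
      using c v(1) real unfolding c'_def by (auto simp: less_Suc_eq)
    moreover have "\<forall>k<Suc m. \<forall>i<n. app_n n a (q' k) i = of_real (c' k) * q' k i"
    proof -
      have "app_n n a v i = of_real (Re \<mu>) * v i" if "i < n" for i
        using app_b[of v i] v(3)[OF that] qv real by simp
      then show ?thesis using ev unfolding q'_def c'_def by (auto simp: less_Suc_eq)
    qed
    ultimately show ?case by blast
  qed
  from this[of "Suc n"] obtain q where "orthonormal_n n (Suc n) q" by blast
  then show False using orthonormal_n_card by fastforce
qed

subsection \<open>Singular values and the trace norm\<close>

definition entry :: "complex mat \<Rightarrow> nat \<Rightarrow> nat \<Rightarrow> complex" where
  "entry A i j = A $$ (i, j)"

lemma app_n_add: "app_n n a (\<lambda>j. u j + v j) = (\<lambda>i. app_n n a u i + app_n n a v i)"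
  by (simp add: fun_eq_iff app_n_def algebra_simps sum.distrib)

lemma app_n_scale: "app_n n a (\<lambda>j. c * u j) = (\<lambda>i. c * app_n n a u i)"
  by (simp add: fun_eq_iff app_n_def sum_distrib_left mult_ac)

lemma app_n_diff: "app_n n a (\<lambda>j. u j - v j) = (\<lambda>i. app_n n a u i - app_n n a v i)"
  by (simp add: fun_eq_iff app_n_def algebra_simps sum_subtractf)

lemma app_n_sum: "app_n n a (\<lambda>j. \<Sum>k\<in>K. c k * q k j) = (\<lambda>i. \<Sum>k\<in>K. c k * app_n n a (q k) i)"
  unfolding app_n_def sum_distrib_left fun_eq_iff by (subst sum.swap) (simp add: mult_ac)

lemma app_n_cong:
  assumes "\<And>j. j < n \<Longrightarrow> a i j = b i j" "\<And>j. j < n \<Longrightarrow> u j = v j"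
  shows "app_n n a u i = app_n n b v i"
  unfolding app_n_def using assms by (intro sum.cong) auto

lemma inner_n_add_left: "inner_n n (\<lambda>i. u i + v i) w = inner_n n u w + inner_n n v w"
  by (simp add: inner_n_def sum.distrib algebra_simps)

lemma app_n_dyad_sum:
  "app_n n (dyad_sum m c y q) v i = (\<Sum>k<m. of_real (c k) * inner_n n (q k) v * y k i)"
  unfolding app_n_def dyad_sum_def inner_n_def sum_distrib_right sum_distrib_left
  by (subst sum.swap) (simp add: mult_ac)

lemma inner_n_app_dyad_sum:
  "inner_n n u (app_n n (dyad_sum m c y q) v)
    = (\<Sum>k<m. of_real (c k) * inner_n n (q k) v * inner_n n u (y k))"
proof -
  have "inner_n n u (app_n n (dyad_sum m c y q) v)
      = inner_n n u (\<lambda>i. \<Sum>k<m. of_real (c k) * inner_n n (q k) v * y k i)"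
    by (intro inner_n_cong) (simp_all add: app_n_dyad_sum)
  then show ?thesis by (simp add: inner_n_sum_right)
qed

text \<open>The family \<open>q\<close> meets itself in the middle of the product, and
  orthonormality removes all cross terms.\<close>

lemma dyad_sum_mult:
  assumes "orthonormal_n n m q"
  shows "(\<Sum>l<n. dyad_sum m c y q i l * dyad_sum m c' q z l j) = dyad_sum m (\<lambda>k. c k * c' k) y z i j"
proof -
  have "(\<Sum>l<n. dyad_sum m c y q i l * dyad_sum m c' q z l j)
      = app_n n (dyad_sum m c y q) (\<lambda>l. \<Sum>k<m. (of_real (c' k) * cnj (z k j)) * q k l) i"
    unfolding app_n_def by (intro sum.cong refl) (simp add: dyad_sum_def mult_ac)
  also have "\<dots> = (\<Sum>k<m. (of_real (c' k) * cnj (z k j)) * app_n n (dyad_sum m c y q) (q k) i)"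
    unfolding app_n_sum ..
  also have "\<dots> = dyad_sum m (\<lambda>k. c k * c' k) y z i j"
    unfolding dyad_sum_def[of m "\<lambda>k. c k * c' k"]
  proof (intro sum.cong refl)
    fix k assume k: "k \<in> {..<m}"
    have "app_n n (dyad_sum m c y q) (q k) i = (\<Sum>l<m. if l = k then of_real (c l) * y l i else 0)"
      unfolding app_n_dyad_sum using assms k
      by (intro sum.cong refl) (auto simp: orthonormal_n_def)
    also have "\<dots> = of_real (c k) * y k i" using k by simp
    finally show "of_real (c' k) * cnj (z k j) * app_n n (dyad_sum m c y q) (q k) i
        = of_real (c k * c' k) * y k i * cnj (z k j)" by simp
  qed
  finally show ?thesis .
qed

section \<open>Positive semidefinite matrices and the uniqueness of their square roots\<close>

lemma psd_iff:
  "psd n A \<longleftrightarrow> A \<in> carrier_mat n n \<and> (\<forall>u. 0 \<le> inner_n n u (app_n n (entry A) u))"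
proof -
  have eq: "(A *\<^sub>v v) \<bullet>c v = inner_n n (\<lambda>i. v $ i) (app_n n (entry A) (\<lambda>i. v $ i))"
    if "A \<in> carrier_mat n n" "v \<in> carrier_vec n" for v
    using that
    by (auto simp: scalar_prod_def inner_n_def app_n_def entry_def atLeast0LessThan mult.commute
        intro!: sum.cong)
  show ?thesis
  proof
    assume psd: "psd n A"
    then have A: "A \<in> carrier_mat n n" by (simp add: psd_def)
    have "0 \<le> inner_n n u (app_n n (entry A) u)" for u
    proof -
      have "0 \<le> (A *\<^sub>v vec n u) \<bullet>c vec n u" using psd unfolding psd_def by auto
      also have "\<dots> = inner_n n u (app_n n (entry A) u)"
        unfolding eq[OF A vec_carrier] by (intro inner_n_cong app_n_cong) auto
      finally show ?thesis .
    qed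
    with A show "A \<in> carrier_mat n n \<and> (\<forall>u. 0 \<le> inner_n n u (app_n n (entry A) u))" by blast
  next
    assume "A \<in> carrier_mat n n \<and> (\<forall>u. 0 \<le> inner_n n u (app_n n (entry A) u))"
    then show "psd n A" unfolding psd_def by (auto simp: eq)
  qed
qed

text \<open>This is the arithmetic behind polarization, with \<open>p\<close> and \<open>q\<close>
  standing for the values of a sesquilinear form at \<open>(u, v)\<close> and
  \<open>(v, u)\<close>.\<close>

lemma complex_polarization:
  fixes p q :: complex
  assumes "Im (p + q) = 0" "Im (\<i> * p - \<i> * q) = 0"
  shows "p = cnj q"
  using assms by (simp add: complex_eq_iff)

text \<open>The form \<open>s\<close> is real at equal arguments. Evaluating it at
  \<open>u + v\<close>, and at \<open>u\<close> plus the imaginary unit times \<open>v\<close>,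
  shows that it is conjugate symmetric; basis vectors then read off the entries.\<close>

lemma psd_hermitian_n:
  assumes "psd n A"
  shows "hermitian_n n (entry A)"
proof -
  define s where "s u v = inner_n n u (app_n n (entry A) v)" for u v
  have real: "Im (s u u) = 0" for u
    using assms unfolding psd_iff s_def less_eq_complex_def by simp
  have im: "Im (s u v + s v u) = 0" for u v
  proof -
    have "s (\<lambda>i. u i + v i) (\<lambda>i. u i + v i) = s u u + s u v + (s v u + s v v)"
      unfolding s_def app_n_add inner_n_add_left inner_n_add_right by simp
    then show ?thesis using real[of "\<lambda>i. u i + v i"] real[of u] real[of v] by simp
  qed
  have sym: "s u v = cnj (s v u)" for u v
  proof (rule complex_polarization)
    have "s u (\<lambda>i. \<i> * v i) = \<i> * s u v" "s (\<lambda>i. \<i> * v i) u = - \<i> * s v u"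
      unfolding s_def app_n_scale inner_n_scale_right inner_n_scale_left by simp_all
    then show "Im (\<i> * s u v - \<i> * s v u) = 0" using im[of u "\<lambda>i. \<i> * v i"] by simp
  qed (rule im)
  have e: "s (\<lambda>k. of_bool (k = i)) (\<lambda>k. of_bool (k = j)) = entry A i j" if "i < n" "j < n" for i j
  proof -
    have "app_n n (entry A) (\<lambda>k. of_bool (k = j)) l = (\<Sum>k<n. if k = j then entry A l k else 0)" for l
      unfolding app_n_def by (intro sum.cong) auto
    moreover have "s (\<lambda>k. of_bool (k = i)) v = (\<Sum>k<n. if k = i then app_n n (entry A) v k else 0)" for v
      unfolding s_def inner_n_def by (intro sum.cong) auto
    ultimately show ?thesis using that by simp
  qed
  show ?thesis
    unfolding hermitian_n_def
  proof (intro allI impI)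
    fix i j assume "i < n" "j < n"
    then show "entry A j i = cnj (entry A i j)"
      using sym[of "\<lambda>k. of_bool (k = j)" "\<lambda>k. of_bool (k = i)"] e[of i j] e[of j i] by simp
  qed
qed

lemma entry_mult:
  assumes "A \<in> carrier_mat n n" "B \<in> carrier_mat n n" "i < n" "j < n"
  shows "entry (A * B) i j = (\<Sum>l<n. entry A i l * entry B l j)"
  using assms by (simp add: entry_def scalar_prod_def atLeast0LessThan)

lemma app_n_mult:
  assumes "A \<in> carrier_mat n n" "B \<in> carrier_mat n n" "i < n"
  shows "app_n n (entry (A * B)) u i = app_n n (entry A) (app_n n (entry B) u) i"
proof -
  have "app_n n (entry (A * B)) u i = (\<Sum>j<n. \<Sum>l<n. entry A i l * (entry B l j * u j))"
    unfolding app_n_def using assms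
    by (intro sum.cong refl) (auto simp: entry_mult[OF assms(1,2)] sum_distrib_left mult_ac)
  also have "\<dots> = (\<Sum>l<n. \<Sum>j<n. entry A i l * (entry B l j * u j))" by (rule sum.swap)
  finally show ?thesis unfolding app_n_def sum_distrib_left .
qed

text \<open>With \<open>D = P - R\<close> and \<open>S = P + R\<close>, equal squares give \<open>D S + S D = 0\<close>. An eigenvector of \<open>D\<close> for an
  eigenvalue \<open>\<delta> \<noteq> 0\<close> then satisfies \<open>\<langle>v, S v\<rangle> = 0\<close>, hence \<open>\<langle>v, P v\<rangle> = \<langle>v, R v\<rangle> = 0\<close> and \<open>\<delta> = 0\<close>.\<close>

lemma psd_square_inj:
  assumes P: "psd n P" and R: "psd n R" and eq: "P * P = R * R"
  shows "P = R"
proof -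
  have cP: "P \<in> carrier_mat n n" and cR: "R \<in> carrier_mat n n"
    using P R by (auto simp: psd_def)
  define p where "p = app_n n (entry P)"
  define r where "r = app_n n (entry R)"
  define D where "D i j = entry P i j - entry R i j" for i j
  have hP: "hermitian_n n (entry P)" and hR: "hermitian_n n (entry R)"
    using P R by (auto intro: psd_hermitian_n)
  have hD: "hermitian_n n D"
    unfolding hermitian_n_def D_def
    using hermitian_nD[OF hP] hermitian_nD[OF hR] by (metis complex_cnj_diff)
  have appD: "app_n n D v = (\<lambda>i. p v i - r v i)" for v
    by (simp add: app_n_def D_def p_def r_def algebra_simps sum_subtractf fun_eq_iff)
  have "D i j = 0" if ij: "i < n" "j < n" for i j
  proof (rule ccontr)
    assume "D i j \<noteq> 0"
    then obtain \<delta> v where v: "\<delta> \<noteq> 0" "inner_n n v v = 1" "\<And>i. i < n \<Longrightarrow> app_n n D v i = \<delta> * v i"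
      using hermitian_n_nonzero_eigenvalue[OF hD ij] by blast
    have \<delta>: "cnj \<delta> = \<delta>" using hermitian_n_eigenvalue_real[OF hD v(2,3)] by (metis complex_cnj_complex_of_real)
    have pp: "p (p v) i = r (r v) i" if "i < n" for i
      using app_n_mult[OF cP cP that, of v] app_n_mult[OF cR cR that, of v] eq
      unfolding p_def r_def by simp
    have \<delta>v: "p v i - r v i = \<delta> * v i" if "i < n" for i
      using v(3)[OF that] unfolding appD .
    have "inner_n n (\<lambda>i. \<delta> * v i) (\<lambda>i. p v i + r v i) = inner_n n (app_n n D v) (\<lambda>i. p v i + r v i)"
      by (intro inner_n_cong) (simp_all add: v(3))
    also have "\<dots> = inner_n n v (app_n n D (\<lambda>i. p v i + r v i))"
      using hermitian_n_inner[OF hD] by simp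
    \<comment> \<open>Expanding (P - R)(P + R) v, the squares cancel because they are equal; only
      the commutator terms remain.\<close>
    also have "\<dots> = inner_n n v (\<lambda>i. p (r v) i - r (p v) i)"
    proof (intro inner_n_cong refl)
      fix i assume i: "i < n"
      have "app_n n D (\<lambda>i. p v i + r v i) i = (p (p v) i + p (r v) i) - (r (p v) i + r (r v) i)"
        unfolding appD p_def r_def app_n_add by (simp add: algebra_simps)
      then show "app_n n D (\<lambda>i. p v i + r v i) i = p (r v) i - r (p v) i" using pp[OF i] by simp
    qed
    also have "\<dots> = inner_n n v (p (r v)) - inner_n n v (r (p v))"
      by (rule inner_n_diff_right)
    also have "\<dots> = inner_n n (p v) (r v) - inner_n n (r v) (p v)"
      unfolding p_def r_def hermitian_n_inner[OF hP] hermitian_n_inner[OF hR] ..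
    finally have "\<delta> * inner_n n v (\<lambda>i. p v i + r v i) = inner_n n (p v) (r v) - inner_n n (r v) (p v)"
      unfolding inner_n_scale_left \<delta> .
    then have 1: "\<delta> * (inner_n n v (p v) + inner_n n v (r v)) = inner_n n (p v) (r v) - inner_n n (r v) (p v)"
      unfolding inner_n_add_right .
    have pv: "0 \<le> inner_n n v (p v)" and rv: "0 \<le> inner_n n v (r v)"
      using P R unfolding psd_iff p_def r_def by blast+
    \<comment> \<open>In equation \<open>1\<close> the left side is real, and the right side, a
      number minus its conjugate, is purely imaginary; so both vanish.\<close>
    have "\<delta> * (inner_n n v (p v) + inner_n n v (r v)) = 0"
    proof -
      have "Im (\<delta> * (inner_n n v (p v) + inner_n n v (r v))) = 0"
        using pv rv \<delta> by (simp add: less_eq_complex_def complex_eq_iff)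
      moreover have "Re (inner_n n (p v) (r v) - inner_n n (r v) (p v)) = 0"
        using inner_n_cnj[of n "p v" "r v"] by (metis complex_cnj(1) diff_self minus_complex.simps(1) cnj.sel(1))
      ultimately show ?thesis using 1 by (simp add: complex_eq_iff)
    qed
    then have "inner_n n v (p v) + inner_n n v (r v) = 0" using v(1) by simp
    then have "inner_n n v (p v) = 0 \<and> inner_n n v (r v) = 0"
      using pv rv by (simp add: add_nonneg_eq_0_iff)
    moreover have "inner_n n v (p v) - inner_n n v (r v) = \<delta>"
    proof -
      have "inner_n n v (\<lambda>i. p v i - r v i) = inner_n n v (\<lambda>i. \<delta> * v i)"
        by (intro inner_n_cong) (simp_all add: \<delta>v)
      then show ?thesis unfolding inner_n_diff_right inner_n_scale_right v(2) by simp
    qed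
    ultimately show False using v(1) by simp
  qed
  then show ?thesis using cP cR by (intro eq_matI) (auto simp: D_def entry_def)
qed

lemma mat_adjoint_carrier: "X \<in> carrier_mat n m \<Longrightarrow> mat_adjoint X \<in> carrier_mat m n"
  unfolding mat_adjoint_def by (auto simp: mat_of_rows_def)

lemma mat_adjoint_index:
  assumes "X \<in> carrier_mat n m" "i < m" "j < n"
  shows "mat_adjoint X $$ (i, j) = cnj (X $$ (j, i))"
  using assms unfolding mat_adjoint_def by (auto simp: mat_of_rows_def)

section \<open>Singular value decomposition and the absolute value\<close>

lemma inner_n_app_n_both:
  "inner_n n (app_n n x u) (app_n n x v) = inner_n n u (app_n n (\<lambda>i j. \<Sum>l<n. cnj (x l i) * x l j) v)"
proof -
  have "inner_n n (app_n n x u) (app_n n x v)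
      = (\<Sum>l<n. \<Sum>i<n. \<Sum>j<n. cnj (u i) * (cnj (x l i) * x l j) * v j)"
    unfolding inner_n_def app_n_def cnj_sum sum_product by (simp add: mult_ac)
  also have "\<dots> = (\<Sum>i<n. \<Sum>l<n. \<Sum>j<n. cnj (u i) * (cnj (x l i) * x l j) * v j)"
    by (rule sum.swap)
  also have "\<dots> = (\<Sum>i<n. \<Sum>j<n. \<Sum>l<n. cnj (u i) * (cnj (x l i) * x l j) * v j)"
    by (intro sum.cong refl sum.swap)
  also have "\<dots> = inner_n n u (app_n n (\<lambda>i j. \<Sum>l<n. cnj (x l i) * x l j) v)"
    unfolding inner_n_app_n by (simp add: sum_distrib_left sum_distrib_right)
  finally show ?thesis .
qed

text \<open>Diagonalize X\<dagger> X as \<Sum> c q q\<dagger> with nonzero \<open>c\<close>. Then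
  \<open>c k\<close> is the squared norm of \<open>X (q k)\<close>, so it is positive, and the left
  vectors are \<open>y k = X (q k) / s k\<close> with \<open>s k = sqrt (c k)\<close>. Zero singular
  values never appear. The trace norm is read off from |X| = \<Sum> s q q\<dagger>.\<close>

theorem singular_value_decomposition:
  assumes X: "X \<in> carrier_mat n n"
  obtains m s y q where "orthonormal_n n m y" "orthonormal_n n m q" "\<And>k. k < m \<Longrightarrow> 0 < s k"
    "\<And>i j. i < n \<Longrightarrow> j < n \<Longrightarrow> X $$ (i, j) = dyad_sum m s y q i j"
    "trace_norm X = (\<Sum>k<m. s k)"
proof -
  define x where "x = entry X"
  define a where "a i j = (\<Sum>l<n. cnj (x l i) * x l j)" for i j
  have herm: "hermitian_n n a" by (simp add: hermitian_n_def a_def mult.commute)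
  obtain m c q where q: "orthonormal_n n m q" and c0: "\<And>k. k < m \<Longrightarrow> c k \<noteq> (0::real)"
    and a: "\<And>i j. i < n \<Longrightarrow> j < n \<Longrightarrow> a i j = dyad_sum m c q q i j"
    by (rule spectral_decomposition[OF herm]) blast
  have gram: "inner_n n (app_n n x u) (app_n n x v)
      = (\<Sum>k<m. of_real (c k) * inner_n n (q k) v * inner_n n u (q k))" for u v
  proof -
    have "inner_n n (app_n n x u) (app_n n x v) = inner_n n u (app_n n a v)"
      unfolding inner_n_app_n_both a_def[abs_def] ..
    also have "\<dots> = inner_n n u (app_n n (dyad_sum m c q q) v)"
      by (intro inner_n_cong app_n_cong) (simp_all add: a)
    finally show ?thesis unfolding inner_n_app_dyad_sum .
  qed
  define xq where "xq k = app_n n x (q k)" for k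
  have xq: "inner_n n (xq k) (xq l) = (if k = l then of_real (c k) else 0)" if "k < m" "l < m" for k l
  proof -
    have "inner_n n (xq k) (xq l) = (\<Sum>j<m. if j = k then of_real (c j) * of_bool (j = l) else 0)"
      unfolding xq_def gram using q that by (intro sum.cong refl) (auto simp: orthonormal_n_def)
    then show ?thesis using that by simp
  qed
  have cpos: "0 < c k" if "k < m" for k
  proof -
    have "c k = (norm_n n (xq k))\<^sup>2"
      using xq[OF that that] unfolding inner_n_self by (metis of_real_eq_iff)
    then show ?thesis using c0[OF that] by (metis zero_less_power2 zero_eq_power2)
  qed
  define s where "s k = sqrt (c k)" for k
  have s: "0 < s k" "s k * s k = c k" if "k < m" for k
    using cpos[OF that] by (simp_all add: s_def)
  define y where "y k = (\<lambda>i. of_real (1 / s k) * xq k i)" for k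
  have y: "orthonormal_n n m y"
    unfolding orthonormal_n_def
  proof (intro allI impI)
    fix k l assume kl: "k < m" "l < m"
    show "inner_n n (y k) (y l) = of_bool (k = l)"
    proof (cases "k = l")
      case True
      have "complex_of_real (c k) = of_real (s k) * of_real (s k)" using s(2)[OF kl(1)] by (metis of_real_mult)
      then show ?thesis
        unfolding y_def inner_n_scale_left inner_n_scale_right xq[OF kl] using True s(1)[OF kl(1)] by simp
    next
      case False
      then show ?thesis unfolding y_def inner_n_scale_left inner_n_scale_right xq[OF kl] by simp
    qed
  qed
  have Xd: "X $$ (i, j) = dyad_sum m s y q i j" if ij: "i < n" "j < n" for i j
  proof -
    \<comment> \<open>The part of the basis vector at \<open>j\<close> that is orthogonal to all
      \<open>q k\<close> lies in the kernel of \<open>X\<close> by \<open>gram\<close>. Hence column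
      \<open>j\<close> of \<open>X\<close> is determined by the vectors
      \<open>X (q k)\<close>.\<close>
    define u where "u = (\<lambda>t. of_bool (t = j) - (\<Sum>k<m. cnj (q k j) * q k t))"
    have ej: "inner_n n (q k) (\<lambda>t. of_bool (t = j)) = cnj (q k j)" for k
    proof -
      have "inner_n n (q k) (\<lambda>t. of_bool (t = j)) = (\<Sum>t<n. if t = j then cnj (q k t) else 0)"
        unfolding inner_n_def by (intro sum.cong) auto
      then show ?thesis using ij by simp
    qed
    have qu: "inner_n n (q k) u = 0" if "k < m" for k
    proof -
      have "(\<Sum>l<m. cnj (q l j) * inner_n n (q k) (q l)) = (\<Sum>l<m. if l = k then cnj (q l j) else 0)"
        using q that by (intro sum.cong refl) (auto simp: orthonormal_n_def)
      also have "\<dots> = cnj (q k j)" using that by simp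
      finally show ?thesis unfolding u_def inner_n_diff_right inner_n_sum_right ej by simp
    qed
    have "inner_n n (app_n n x u) (app_n n x u) = 0"
      unfolding gram using qu by simp
    then have "app_n n x u i = 0" using inner_n_self_eq_0_iff ij by blast
    moreover have "app_n n x u i = x i j - (\<Sum>k<m. cnj (q k j) * xq k i)"
    proof -
      have "app_n n x (\<lambda>t. of_bool (t = j)) i = (\<Sum>t<n. if t = j then x i t else 0)"
        unfolding app_n_def by (intro sum.cong) auto
      then have "app_n n x (\<lambda>t. of_bool (t = j)) i = x i j" using ij by simp
      then show ?thesis unfolding u_def app_n_diff app_n_sum xq_def by simp
    qed
    ultimately have "x i j = (\<Sum>k<m. cnj (q k j) * xq k i)" by simp
    also have "\<dots> = dyad_sum m s y q i j"
      unfolding dyad_sum_def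
    proof (intro sum.cong refl)
      fix k assume "k \<in> {..<m}"
      then have "of_real (s k) \<noteq> (0::complex)" using s(1)[of k] by simp
      then show "cnj (q k j) * xq k i = of_real (s k) * y k i * cnj (q k j)"
        unfolding y_def by simp
    qed
    finally show ?thesis unfolding x_def entry_def .
  qed
  \<comment> \<open>This is the candidate for |X|. Its square is X\<dagger> X, and
    \<open>psd_square_inj\<close> supplies the uniqueness that the definite description in
    \<open>mat_abs\<close> requires.\<close>
  define P where "P = mat n n (\<lambda>(i, j). dyad_sum m s q q i j)"
  have P: "P \<in> carrier_mat n n" by (simp add: P_def)
  have entP: "entry P i j = dyad_sum m s q q i j" if "i < n" "j < n" for i j
    using that by (simp add: P_def entry_def)
  have psd: "psd n P"
    unfolding psd_iff
  proof (intro conjI allI)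
    fix u
    have "inner_n n u (app_n n (entry P) u) = inner_n n u (app_n n (dyad_sum m s q q) u)"
      by (intro inner_n_cong app_n_cong) (simp_all add: entP)
    also have "\<dots> = (\<Sum>k<m. of_real (s k * (cmod (inner_n n u (q k)))\<^sup>2))"
      unfolding inner_n_app_dyad_sum of_real_mult complex_norm_square inner_n_cnj
      by (simp add: mult_ac)
    also have "0 \<le> \<dots>"
      using s(1) by (intro sum_nonneg) (simp add: less_eq_complex_def less_imp_le)
    finally show "0 \<le> inner_n n u (app_n n (entry P) u)" .
  qed (rule P)
  have XX: "mat_adjoint X * X \<in> carrier_mat n n"
    using mat_adjoint_carrier[OF X] X by simp
  have PP: "P * P = mat_adjoint X * X"
  proof (rule eq_matI)
    fix i j assume "i < dim_row (mat_adjoint X * X)" "j < dim_col (mat_adjoint X * X)"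
    then have ij: "i < n" "j < n" using XX by auto
    have "entry (P * P) i j = (\<Sum>l<n. dyad_sum m s q q i l * dyad_sum m s q q l j)"
      using ij unfolding entry_mult[OF P P ij] by (intro sum.cong) (auto simp: entP)
    also have "\<dots> = dyad_sum m (\<lambda>k. s k * s k) q q i j" by (rule dyad_sum_mult[OF q])
    also have "\<dots> = a i j" unfolding a[OF ij] dyad_sum_def using s(2) by (intro sum.cong) auto
    also have "\<dots> = entry (mat_adjoint X * X) i j"
      unfolding entry_mult[OF mat_adjoint_carrier[OF X] X ij] a_def
      using ij by (intro sum.cong) (auto simp: x_def entry_def mat_adjoint_index[OF X])
    finally show "(P * P) $$ (i, j) = (mat_adjoint X * X) $$ (i, j)" unfolding entry_def .
  qed (use P XX in auto)
  have "mat_abs X = P"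
    unfolding mat_abs_def
  proof (rule the_equality)
    show "psd (dim_col X) P \<and> P * P = mat_adjoint X * X" using psd PP X by simp
    show "R = P" if "psd (dim_col X) R \<and> R * R = mat_adjoint X * X" for R
      using that psd PP X psd_square_inj[of n R P] by simp
  qed
  then have "mat_trace (mat_abs X) = (\<Sum>i<n. dyad_sum m s q q i i)"
    unfolding mat_trace_def using entP P by (auto simp: entry_def intro!: sum.cong)
  also have "\<dots> = (\<Sum>k<m. of_real (s k) * inner_n n (q k) (q k))"
    unfolding dyad_sum_def inner_n_def sum_distrib_left by (subst sum.swap) (simp add: mult_ac)
  also have "\<dots> = (\<Sum>k<m. of_real (s k))"
    using q by (intro sum.cong refl) (auto simp: orthonormal_n_def)
  finally have "trace_norm X = (\<Sum>k<m. s k)" unfolding trace_norm_def by simp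
  then show thesis using that[OF y q s(1) Xd] by blast
qed

subsection \<open>Duality between the trace norm and contractions\<close>

lemma norm_n_mult_ineq: "(\<Sum>i<n. cmod (u i) * cmod (v i)) \<le> norm_n n u * norm_n n v"
  using L2_set_mult_ineq[of "\<lambda>i. cmod (u i)" "\<lambda>i. cmod (v i)" "{..<n}"]
  by (simp add: norm_n_def)

text \<open>This is Tr (W X).\<close>

definition pairing :: "nat \<Rightarrow> (nat \<Rightarrow> nat \<Rightarrow> complex) \<Rightarrow> (nat \<Rightarrow> nat \<Rightarrow> complex) \<Rightarrow> complex" where
  "pairing n w x = (\<Sum>i<n. \<Sum>j<n. w i j * x j i)"

definition bilinear_n :: "nat \<Rightarrow> (nat \<Rightarrow> complex) \<Rightarrow> (nat \<Rightarrow> nat \<Rightarrow> complex) \<Rightarrow> (nat \<Rightarrow> complex) \<Rightarrow> complex"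
  where "bilinear_n n u w v = (\<Sum>i<n. \<Sum>j<n. u i * w i j * v j)"

text \<open>Operator norm at most 1. The form \<open>bilinear_n\<close> conjugates neither argument,
  which is harmless because conjugation preserves \<open>norm_n\<close> and \<open>u\<close> is
  arbitrary.\<close>

definition contraction_n :: "nat \<Rightarrow> (nat \<Rightarrow> nat \<Rightarrow> complex) \<Rightarrow> bool" where
  "contraction_n n w \<longleftrightarrow> (\<forall>u v. cmod (bilinear_n n u w v) \<le> norm_n n u * norm_n n v)"

lemma contraction_nD: "contraction_n n w \<Longrightarrow> cmod (bilinear_n n u w v) \<le> norm_n n u * norm_n n v"
  unfolding contraction_n_def by blast

lemma norm_n_cnj [simp]: "norm_n n (\<lambda>i. cnj (u i)) = norm_n n u"
  by (simp add: norm_n_def)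

lemma bilinear_n_dyad_sum:
  "bilinear_n n u (dyad_sum m c y q) v
    = (\<Sum>k<m. of_real (c k) * inner_n n (\<lambda>i. cnj (u i)) (y k) * inner_n n (q k) v)"
proof -
  have "bilinear_n n u (dyad_sum m c y q) v = inner_n n (\<lambda>i. cnj (u i)) (app_n n (dyad_sum m c y q) v)"
    unfolding inner_n_app_n bilinear_n_def by simp
  then show ?thesis unfolding inner_n_app_dyad_sum by (simp add: mult_ac)
qed

lemma pairing_dyad_sum:
  "pairing n w (dyad_sum m c y q) = (\<Sum>k<m. of_real (c k) * bilinear_n n (\<lambda>i. cnj (q k i)) w (y k))"
proof -
  have "pairing n w (dyad_sum m c y q)
      = (\<Sum>i<n. \<Sum>j<n. \<Sum>k<m. of_real (c k) * (cnj (q k i) * w i j * y k j))"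
    unfolding pairing_def dyad_sum_def sum_distrib_left by (simp add: mult_ac)
  also have "\<dots> = (\<Sum>i<n. \<Sum>k<m. \<Sum>j<n. of_real (c k) * (cnj (q k i) * w i j * y k j))"
    by (intro sum.cong refl sum.swap)
  also have "\<dots> = (\<Sum>k<m. \<Sum>i<n. \<Sum>j<n. of_real (c k) * (cnj (q k i) * w i j * y k j))"
    by (rule sum.swap)
  finally show ?thesis unfolding bilinear_n_def sum_distrib_left .
qed

lemma orthonormal_n_norm:
  assumes "orthonormal_n n m q" "k < m"
  shows "norm_n n (q k) = 1"
proof -
  have "complex_of_real ((norm_n n (q k))\<^sup>2) = of_real 1"
    using assms unfolding orthonormal_n_def inner_n_self[symmetric] by simp
  then have "(norm_n n (q k))\<^sup>2 = 1" using of_real_eq_iff by blast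
  then show ?thesis using norm_n_nonneg[of n "q k"] by (simp add: power2_eq_1_iff)
qed

lemma pairing_cong:
  assumes "\<And>i j. i < n \<Longrightarrow> j < n \<Longrightarrow> x i j = x' i j"
  shows "pairing n w x = pairing n w x'"
  unfolding pairing_def using assms by (intro sum.cong) auto

text \<open>Inserting the singular value decomposition turns the pairing into \<Sum> s (q\<dagger> W
  y), where each factor of \<open>s k\<close> has modulus at most 1 since \<open>q k\<close> and
  \<open>y k\<close> are unit vectors.\<close>

lemma pairing_le_trace_norm:
  assumes X: "X \<in> carrier_mat n n" and w: "contraction_n n w"
  shows "cmod (pairing n w (entry X)) \<le> trace_norm X"
proof -
  obtain m s y q where y: "orthonormal_n n m y" and q: "orthonormal_n n m q"
    and s: "\<And>k. k < m \<Longrightarrow> 0 < s k"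
    and Xd: "\<And>i j. i < n \<Longrightarrow> j < n \<Longrightarrow> X $$ (i, j) = dyad_sum m s y q i j"
    and tr: "trace_norm X = (\<Sum>k<m. s k)"
    by (rule singular_value_decomposition[OF X]) blast
  have "pairing n w (entry X) = (\<Sum>k<m. of_real (s k) * bilinear_n n (\<lambda>i. cnj (q k i)) w (y k))"
    using pairing_cong[of n "entry X" "dyad_sum m s y q"] Xd
    unfolding entry_def pairing_dyad_sum by auto
  also have "cmod \<dots> \<le> (\<Sum>k<m. s k)"
  proof (rule sum_norm_le)
    fix k assume "k \<in> {..<m}"
    then have k: "k < m" by simp
    have "cmod (bilinear_n n (\<lambda>i. cnj (q k i)) w (y k)) \<le> 1"
      using contraction_nD[OF w, of "\<lambda>i. cnj (q k i)" "y k"] orthonormal_n_norm[OF q k]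
        orthonormal_n_norm[OF y k] by simp
    then show "cmod (of_real (s k) * bilinear_n n (\<lambda>i. cnj (q k i)) w (y k)) \<le> s k"
      using s[OF k] by (simp add: norm_mult)
  qed
  finally show ?thesis unfolding tr .
qed

text \<open>The optimal contraction is the partial isometry \<Sum> q y\<dagger>, which sends
  \<open>y k\<close> to \<open>q k\<close>, so that each singular value enters the pairing with
  coefficient 1. It is a contraction by Cauchy-Schwarz and two applications of Bessel's
  inequality.\<close>

lemma trace_norm_eq_pairing:
  assumes X: "X \<in> carrier_mat n n"
  obtains w where "contraction_n n w" "pairing n w (entry X) = of_real (trace_norm X)"
proof -
  obtain m s y q where y: "orthonormal_n n m y" and q: "orthonormal_n n m q"
    and s: "\<And>k. k < m \<Longrightarrow> 0 < s k"
    and Xd: "\<And>i j. i < n \<Longrightarrow> j < n \<Longrightarrow> X $$ (i, j) = dyad_sum m s y q i j"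
    and tr: "trace_norm X = (\<Sum>k<m. s k)"
    by (rule singular_value_decomposition[OF X]) blast
  define w where "w = dyad_sum m (\<lambda>_. 1) q y"
  have "contraction_n n w"
    unfolding contraction_n_def
  proof (intro allI)
    fix u v
    define f where "f k = inner_n n (\<lambda>i. cnj (u i)) (q k)" for k
    define g where "g k = inner_n n (y k) v" for k
    have "bilinear_n n u w v = (\<Sum>k<m. f k * g k)"
      unfolding w_def bilinear_n_dyad_sum f_def g_def by simp
    also have "cmod \<dots> \<le> (\<Sum>k<m. cmod (f k) * cmod (g k))"
      by (rule sum_norm_le) (simp add: norm_mult)
    also have "\<dots> \<le> norm_n m f * norm_n m g" by (rule norm_n_mult_ineq)
    also have "\<dots> \<le> norm_n n u * norm_n n v"
    proof (intro mult_mono norm_n_nonneg)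
      have "(norm_n m f)\<^sup>2 \<le> (norm_n n u)\<^sup>2"
      proof -
        have "cmod (f k) = cmod (inner_n n (q k) (\<lambda>i. cnj (u i)))" for k
          unfolding f_def by (metis complex_mod_cnj inner_n_cnj)
        then show ?thesis
          unfolding norm_n_square[of m] using bessel[OF q, of "\<lambda>i. cnj (u i)"] by simp
      qed
      then show "norm_n m f \<le> norm_n n u" using norm_n_nonneg power2_le_imp_le by blast
      have "(norm_n m g)\<^sup>2 \<le> (norm_n n v)\<^sup>2"
        unfolding norm_n_square[of m] g_def by (rule bessel[OF y])
      then show "norm_n m g \<le> norm_n n v" using norm_n_nonneg power2_le_imp_le by blast
    qed
    finally show "cmod (bilinear_n n u w v) \<le> norm_n n u * norm_n n v" .
  qed
  moreover have "pairing n w (entry X) = of_real (trace_norm X)"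
  proof -
    have "pairing n w (entry X) = (\<Sum>k<m. of_real (s k) * bilinear_n n (\<lambda>i. cnj (q k i)) w (y k))"
      using pairing_cong[of n "entry X" "dyad_sum m s y q"] Xd
      unfolding entry_def pairing_dyad_sum by auto
    also have "\<dots> = (\<Sum>k<m. of_real (s k))"
    proof (intro sum.cong refl)
      fix k assume k: "k \<in> {..<m}"
      have "bilinear_n n (\<lambda>i. cnj (q k i)) w (y k) = (\<Sum>l<m. if l = k then 1 else 0)"
        unfolding w_def bilinear_n_dyad_sum using q y k
        by (intro sum.cong refl) (auto simp: orthonormal_n_def)
      then show "of_real (s k) * bilinear_n n (\<lambda>i. cnj (q k i)) w (y k) = of_real (s k)"
        using k by simp
    qed
    finally show ?thesis unfolding tr by simp
  qed
  ultimately show thesis by (rule that)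
qed

section \<open>The trace norm under embeddings, submatrices and pinchings\<close>

lemma sum_inj_support:
  fixes F :: "nat \<Rightarrow> 'a::comm_monoid_add"
  assumes f: "inj_on f {..<n}" "f ` {..<n} \<subseteq> {..<N}"
    and zero: "\<And>r. r < N \<Longrightarrow> r \<notin> f ` {..<n} \<Longrightarrow> F r = 0"
  shows "(\<Sum>r<N. F r) = (\<Sum>i<n. F (f i))"
proof -
  have "(\<Sum>r<N. F r) = (\<Sum>r\<in>f ` {..<n}. F r)"
    using f(2) zero by (intro sum.mono_neutral_right) auto
  then show ?thesis using f(1) by (simp add: sum.reindex)
qed

text \<open>For injective \<open>f\<close> this applies to \<open>u\<close> the isometry J that
  sends basis vector \<open>i\<close> to basis vector \<open>f i\<close>.\<close>

definition extend_by_zero :: "(nat \<Rightarrow> nat) \<Rightarrow> nat \<Rightarrow> (nat \<Rightarrow> complex) \<Rightarrow> nat \<Rightarrow> complex" where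
  "extend_by_zero f n u r = (if r \<in> f ` {..<n} then u (the_inv_into {..<n} f r) else 0)"

lemma extend_by_zero_simps [simp]:
  assumes "inj_on f {..<n}"
  shows "i < n \<Longrightarrow> extend_by_zero f n u (f i) = u i"
    and "r \<notin> f ` {..<n} \<Longrightarrow> extend_by_zero f n u r = 0"
  using assms by (auto simp: extend_by_zero_def the_inv_into_f_f)

lemma norm_n_extend_by_zero:
  assumes f: "inj_on f {..<n}" "f ` {..<n} \<subseteq> {..<N}"
  shows "norm_n N (extend_by_zero f n u) = norm_n n u"
proof -
  have "(norm_n N (extend_by_zero f n u))\<^sup>2 = (norm_n n u)\<^sup>2"
    unfolding norm_n_square
    by (subst sum_inj_support[OF f]) (use f(1) in \<open>auto intro!: sum.cong\<close>)
  then show ?thesis using norm_n_nonneg power2_eq_iff_nonneg by blast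
qed

lemma norm_n_comp_le:
  assumes f: "inj_on f {..<n}" "f ` {..<n} \<subseteq> {..<N}"
  shows "norm_n n (\<lambda>i. u (f i)) \<le> norm_n N u"
proof -
  have "(norm_n n (\<lambda>i. u (f i)))\<^sup>2 = (\<Sum>r\<in>f ` {..<n}. (cmod (u r))\<^sup>2)"
    unfolding norm_n_square using f(1) by (simp add: sum.reindex)
  also have "\<dots> \<le> (norm_n N u)\<^sup>2"
    unfolding norm_n_square using f(2) by (intro sum_mono2) auto
  finally show ?thesis using norm_n_nonneg power2_le_imp_le by blast
qed

lemma double_sum_inj_support:
  fixes F :: "nat \<Rightarrow> nat \<Rightarrow> complex"
  assumes f: "inj_on f {..<n}" "f ` {..<n} \<subseteq> {..<N}"
    and zero: "\<And>r c. r < N \<Longrightarrow> c < N \<Longrightarrow> r \<notin> f ` {..<n} \<or> c \<notin> f ` {..<n} \<Longrightarrow> F r c = 0"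
  shows "(\<Sum>r<N. \<Sum>c<N. F r c) = (\<Sum>i<n. \<Sum>j<n. F (f i) (f j))"
proof -
  have "(\<Sum>r<N. \<Sum>c<N. F r c) = (\<Sum>i<n. \<Sum>c<N. F (f i) c)"
    by (rule sum_inj_support[OF f]) (simp add: zero)
  also have "\<dots> = (\<Sum>i<n. \<Sum>j<n. F (f i) (f j))"
    using f by (intro sum.cong refl sum_inj_support) (auto simp: zero image_subset_iff)
  finally show ?thesis .
qed

text \<open>Here Y = J X J\<dagger> for the isometry J given by \<open>f\<close>. An optimal
  contraction W for \<open>Y\<close> is compressed to J\<dagger> W J, which pairs with
  \<open>X\<close> to the same value.\<close>

lemma trace_norm_embed_le:
  assumes f: "inj_on f {..<n}" "f ` {..<n} \<subseteq> {..<N}"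
    and X: "X \<in> carrier_mat n n" and Y: "Y \<in> carrier_mat N N"
    and sub: "\<And>i j. i < n \<Longrightarrow> j < n \<Longrightarrow> Y $$ (f i, f j) = X $$ (i, j)"
    and zero: "\<And>r c. r < N \<Longrightarrow> c < N \<Longrightarrow> r \<notin> f ` {..<n} \<or> c \<notin> f ` {..<n} \<Longrightarrow> Y $$ (r, c) = 0"
  shows "trace_norm Y \<le> trace_norm X"
proof -
  obtain w where w: "contraction_n N w" "pairing N w (entry Y) = of_real (trace_norm Y)"
    by (rule trace_norm_eq_pairing[OF Y])
  define w' where "w' i j = w (f i) (f j)" for i j
  have "contraction_n n w'"
    unfolding contraction_n_def
  proof (intro allI)
    fix u v
    have "bilinear_n N (extend_by_zero f n u) w (extend_by_zero f n v) = bilinear_n n u w' v"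
      unfolding bilinear_n_def w'_def
      by (subst double_sum_inj_support[OF f]) (use f(1) in \<open>auto intro!: sum.cong\<close>)
    then show "cmod (bilinear_n n u w' v) \<le> norm_n n u * norm_n n v"
      using contraction_nD[OF w(1), of "extend_by_zero f n u" "extend_by_zero f n v"]
      by (simp add: norm_n_extend_by_zero[OF f])
  qed
  then have "cmod (pairing n w' (entry X)) \<le> trace_norm X"
    by (rule pairing_le_trace_norm[OF X])
  also have "pairing n w' (entry X) = pairing N w (entry Y)"
    unfolding pairing_def w'_def
    by (subst double_sum_inj_support[OF f]) (auto simp: zero sub entry_def intro!: sum.cong)
  finally show ?thesis unfolding w(2) by simp
qed

text \<open>Here X = J\<dagger> Y J, and an optimal contraction W for \<open>X\<close> is inflated
  to J W J\<dagger>.\<close>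

lemma trace_norm_submatrix_le:
  assumes f: "inj_on f {..<n}" "f ` {..<n} \<subseteq> {..<N}"
    and X: "X \<in> carrier_mat n n" and Y: "Y \<in> carrier_mat N N"
    and sub: "\<And>i j. i < n \<Longrightarrow> j < n \<Longrightarrow> Y $$ (f i, f j) = X $$ (i, j)"
  shows "trace_norm X \<le> trace_norm Y"
proof -
  obtain w where w: "contraction_n n w" "pairing n w (entry X) = of_real (trace_norm X)"
    by (rule trace_norm_eq_pairing[OF X])
  \<comment> \<open>Extending one index at a time leaves the indices swapped, with
    \<open>w' (f j) (f i) = w i j\<close>; \<open>w''\<close> restores their order.\<close>
  define w' where "w' r = extend_by_zero f n (\<lambda>i. extend_by_zero f n (w i) r)" for r
  define w'' where "w'' r c = w' c r" for r c
  have w''f: "w'' (f i) (f j) = w i j" if "i < n" "j < n" for i j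
    using that f(1) unfolding w''_def w'_def by simp
  have w''0: "w'' r c = 0" if "r \<notin> f ` {..<n} \<or> c \<notin> f ` {..<n}" for r c
    using that f(1) unfolding w''_def w'_def by (auto simp: extend_by_zero_def)
  have "contraction_n N w''"
    unfolding contraction_n_def
  proof (intro allI)
    fix u v
    have "bilinear_n N u w'' v = bilinear_n n (\<lambda>i. u (f i)) w (\<lambda>i. v (f i))"
      unfolding bilinear_n_def
      by (subst double_sum_inj_support[OF f]) (auto simp: w''f w''0 intro!: sum.cong)
    also have "cmod \<dots> \<le> norm_n n (\<lambda>i. u (f i)) * norm_n n (\<lambda>i. v (f i))"
      by (rule contraction_nD[OF w(1)])
    also have "\<dots> \<le> norm_n N u * norm_n N v"
      by (intro mult_mono norm_n_comp_le[OF f] norm_n_nonneg)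
    finally show "cmod (bilinear_n N u w'' v) \<le> norm_n N u * norm_n N v" .
  qed
  then have "cmod (pairing N w'' (entry Y)) \<le> trace_norm Y"
    by (rule pairing_le_trace_norm[OF Y])
  also have "pairing N w'' (entry Y) = pairing n w (entry X)"
    unfolding pairing_def
    by (subst double_sum_inj_support[OF f]) (auto simp: w''f w''0 sub entry_def intro!: sum.cong)
  finally show ?thesis unfolding w(2) by simp
qed

text \<open>The blocks are the fibres of \<open>g\<close>. Cutting \<open>u\<close> and
  \<open>v\<close> into their parts on the fibres, the pinched form is the sum of the original form
  over matching parts. Each term is at most the product of two norms, and Cauchy-Schwarz over the
  fibres recombines them.\<close>

lemma contraction_n_pinching:
  fixes g :: "nat \<Rightarrow> nat"
  assumes w: "contraction_n n w"
  shows "contraction_n n (\<lambda>i j. if g i = g j then w i j else 0)" (is "contraction_n n ?w'")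
  unfolding contraction_n_def
proof (intro allI)
  fix u v
  define T where "T = g ` {..<n}"
  define cut where "cut t x = (\<lambda>i. if g i = t then x i else (0::complex))" for t x
  define a where "a x t = norm_n n (cut t x)" for x t
  have fin: "finite T" by (simp add: T_def)
  have norm: "(\<Sum>t\<in>T. (a x t)\<^sup>2) = (norm_n n x)\<^sup>2" for x
  proof -
    have "(\<Sum>t\<in>T. (a x t)\<^sup>2) = (\<Sum>t\<in>T. \<Sum>i<n. if g i = t then (cmod (x i))\<^sup>2 else 0)"
      unfolding a_def norm_n_square cut_def by (intro sum.cong refl) auto
    also have "\<dots> = (\<Sum>i<n. \<Sum>t\<in>T. if g i = t then (cmod (x i))\<^sup>2 else 0)"
      by (rule sum.swap)
    also have "\<dots> = (\<Sum>i<n. (cmod (x i))\<^sup>2)"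
      using fin by (intro sum.cong refl) (auto simp: T_def)
    finally show ?thesis by (simp add: norm_n_square)
  qed
  have "bilinear_n n u ?w' v = (\<Sum>i<n. \<Sum>j<n. \<Sum>t\<in>T. cut t u i * w i j * cut t v j)"
    unfolding bilinear_n_def
  proof (intro sum.cong refl)
    fix i j assume ij: "i \<in> {..<n}" "j \<in> {..<n}"
    have "(\<Sum>t\<in>T. cut t u i * w i j * cut t v j) = (\<Sum>t\<in>T. if t = g i then u i * ?w' i j * v j else 0)"
      by (intro sum.cong refl) (auto simp: cut_def)
    also have "\<dots> = u i * ?w' i j * v j" using fin ij by (simp add: T_def)
    finally show "u i * ?w' i j * v j = (\<Sum>t\<in>T. cut t u i * w i j * cut t v j)" by simp
  qed
  also have "\<dots> = (\<Sum>i<n. \<Sum>t\<in>T. \<Sum>j<n. cut t u i * w i j * cut t v j)"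
    by (intro sum.cong refl sum.swap)
  also have "\<dots> = (\<Sum>t\<in>T. bilinear_n n (cut t u) w (cut t v))"
    unfolding bilinear_n_def by (rule sum.swap)
  also have "cmod \<dots> \<le> (\<Sum>t\<in>T. \<bar>a u t\<bar> * \<bar>a v t\<bar>)"
    by (rule sum_norm_le) (simp add: a_def norm_n_nonneg contraction_nD[OF w])
  also have "\<dots> \<le> L2_set (a u) T * L2_set (a v) T" by (rule L2_set_mult_ineq)
  also have "\<dots> = norm_n n u * norm_n n v"
    unfolding L2_set_def norm by (simp add: norm_n_nonneg)
  finally show "cmod (bilinear_n n u ?w' v) \<le> norm_n n u * norm_n n v" .
qed

text \<open>\<open>Y\<close> is \<open>X\<close> minus its pinching. On the dual side Tr (W Y) is a
  difference of two pairings of \<open>X\<close>, with W and with the pinched W, both contractions.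
  This is the source of the factor 2 in the theorem.\<close>

lemma trace_norm_off_diagonal_blocks_le:
  fixes g :: "nat \<Rightarrow> nat"
  assumes X: "X \<in> carrier_mat n n" and Y: "Y \<in> carrier_mat n n"
    and off: "\<And>i j. i < n \<Longrightarrow> j < n \<Longrightarrow> Y $$ (i, j) = (if g i = g j then 0 else X $$ (i, j))"
  shows "trace_norm Y \<le> 2 * trace_norm X"
proof -
  obtain w where w: "contraction_n n w" "pairing n w (entry Y) = of_real (trace_norm Y)"
    by (rule trace_norm_eq_pairing[OF Y])
  define w' where "w' i j = (if g i = g j then w i j else 0)" for i j
  have w': "contraction_n n w'"
    using contraction_n_pinching[OF w(1), of g] unfolding w'_def[abs_def] .
  have "pairing n w (entry Y) = pairing n w (entry X) - pairing n w' (entry X)"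
    unfolding pairing_def sum_subtractf[symmetric]
    by (intro sum.cong refl) (auto simp: off w'_def entry_def)
  then have "cmod (pairing n w (entry Y)) \<le> cmod (pairing n w (entry X)) + cmod (pairing n w' (entry X))"
    by (simp add: norm_triangle_ineq4)
  also have "\<dots> \<le> trace_norm X + trace_norm X"
    by (intro add_mono pairing_le_trace_norm[OF X] w(1) w')
  finally show ?thesis unfolding w(2) by simp
qed

subsection \<open>Mixtures of diagonal unitaries\<close>

text \<open>Rotate \<open>z\<close> onto the nonnegative real axis and take the endpoints of the
  vertical chord through it.\<close>

lemma disc_midpoint_of_circle:
  assumes "cmod z \<le> 1"
  obtains \<alpha> \<beta> where "cmod \<alpha> = 1" "cmod \<beta> = 1" "z = (\<alpha> + \<beta>) / 2"
proof -
  \<comment> \<open>At zero \<open>sgn\<close> would return 0 instead of a phase.\<close>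
  define e where "e = (if z = 0 then 1 else sgn z)"
  have e: "cmod e = 1" and z: "z = of_real (cmod z) * e"
    by (auto simp: e_def sgn_eq norm_divide)
  define h where "h = sqrt (1 - (cmod z)\<^sup>2)"
  have h: "(cmod z)\<^sup>2 + h\<^sup>2 = 1"
    using assms norm_ge_zero[of z] by (simp add: h_def abs_square_le_1)
  have "cmod (Complex (cmod z) h * e) = 1" "cmod (Complex (cmod z) (- h) * e) = 1"
    unfolding norm_mult e complex_norm using h by simp_all
  moreover have "z = (Complex (cmod z) h * e + Complex (cmod z) (- h) * e) / 2"
  proof -
    have "Complex (cmod z) h + Complex (cmod z) (- h) = 2 * of_real (cmod z)"
      by (simp add: complex_eq_iff)
    then have "Complex (cmod z) h * e + Complex (cmod z) (- h) * e = 2 * (of_real (cmod z) * e)"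
      by (simp add: distrib_right[symmetric])
    then show ?thesis using z by simp
  qed
  ultimately show thesis by (rule that)
qed

text \<open>For uniformly random \<open>g\<close> the \<open>\<theta> g i\<close> are independent phases with mean \<open>z i\<close>.\<close>

lemma independent_phases_second_moment:
  fixes z \<alpha> \<beta> :: "nat \<Rightarrow> complex"
  assumes \<alpha>: "\<And>i. i < d \<Longrightarrow> cmod (\<alpha> i) = 1" and \<beta>: "\<And>i. i < d \<Longrightarrow> cmod (\<beta> i) = 1"
    and z: "\<And>i. i < d \<Longrightarrow> z i = (\<alpha> i + \<beta> i) / 2" and ij: "i < d" "j < d"
  defines "\<theta> \<equiv> \<lambda>g l. if g l then \<alpha> l else \<beta> l"
  shows "(\<Sum>g\<in>{..<d} \<rightarrow>\<^sub>E (UNIV :: bool set). (1 / 2) ^ d * (\<theta> g i * cnj (\<theta> g j)))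
    = (if i = j then 1 else z i * cnj (z j))"
proof -
  define t where "t l b = (if b then \<alpha> l else \<beta> l)" for l and b :: bool
  \<comment> \<open>The summand is a product over coordinates, so the sum over all \<open>g\<close>
    becomes a product of sums. The factor 1/2 makes each of these an average over one fair bit,
    which is 1 unless the coordinate is \<open>i\<close> or \<open>j\<close>.\<close>
  define f where "f l b = (1 / 2) * ((if l = i then t l b else 1) * (if l = j then cnj (t l b) else 1))"
    for l b
  have "(\<Prod>l<d. f l (g l)) = (1 / 2) ^ d * (\<theta> g i * cnj (\<theta> g j))" for g
    unfolding f_def prod.distrib using ij by (simp add: t_def \<theta>_def)
  then have "(\<Sum>g\<in>{..<d} \<rightarrow>\<^sub>E (UNIV :: bool set). (1 / 2) ^ d * (\<theta> g i * cnj (\<theta> g j)))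
      = (\<Prod>l<d. \<Sum>b\<in>UNIV. f l b)"
    by (subst prod_sum_PiE) simp_all
  also have "\<dots> = (if i = j then 1 else z i * cnj (z j))"
  proof (cases "i = j")
    case True
    have "(\<Sum>b\<in>UNIV. f l b) = 1" if "l < d" for l
    proof -
      have "t l b * cnj (t l b) = 1" for b
        using \<alpha>[OF that] \<beta>[OF that] by (simp add: t_def complex_norm_square[symmetric])
      then have "f l = (\<lambda>_. 1 / 2)" using True by (cases "l = i") (simp_all add: f_def fun_eq_iff)
      then show ?thesis by simp
    qed
    then show ?thesis using True by simp
  next
    case False
    have "(\<Sum>b\<in>UNIV. f l b) = (if l = i then z l else 1) * (if l = j then cnj (z l) else 1)" if "l < d" for l
      using False z[OF that] arg_cong[OF z[OF that], of cnj]
      by (auto simp: f_def UNIV_bool t_def field_simps)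
    then have "(\<Prod>l<d. \<Sum>b\<in>UNIV. f l b)
        = (\<Prod>l<d. (if l = i then z l else 1) * (if l = j then cnj (z l) else 1))"
      by (intro prod.cong) auto
    also have "\<dots> = z i * cnj (z j)" unfolding prod.distrib using ij by simp
    finally show ?thesis using False by simp
  qed
  finally show ?thesis .
qed

text \<open>Enumerating \<open>I\<close> by a bijection brings the mixture into the form with an
  initial segment as index set; this allows mixtures indexed by pairs of a number and a choice
  function.\<close>

lemma conv_channels_finite:
  assumes I: "finite I" and p: "\<And>x. x \<in> I \<Longrightarrow> 0 \<le> p x" and F: "\<And>x. x \<in> I \<Longrightarrow> F x \<in> T"
    and sum: "(\<Sum>x\<in>I. p x) = 1"
  shows "(\<lambda>X \<in> carrier_mat d d.
      mat d d (\<lambda>(i, j). \<Sum>x\<in>I. complex_of_real (p x) * F x X $$ (i, j))) \<in> conv_channels d T"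
proof -
  obtain h where h: "bij_betw h {..<card I} I"
    using ex_bij_betw_nat_finite[OF I] by (auto simp: atLeast0LessThan)
  have "(\<Sum>k<card I. p (h k)) = 1"
    using sum.reindex_bij_betw[OF h, of p] sum by simp
  moreover have "\<forall>k<card I. 0 \<le> p (h k) \<and> F (h k) \<in> T"
    using h p F by (auto dest: bij_betwE)
  moreover have "(\<lambda>X \<in> carrier_mat d d.
      mat d d (\<lambda>(i, j). \<Sum>x\<in>I. complex_of_real (p x) * F x X $$ (i, j)))
    = (\<lambda>X \<in> carrier_mat d d.
      mat d d (\<lambda>(i, j). \<Sum>k<card I. complex_of_real (p (h k)) * F (h k) X $$ (i, j)))"
    by (intro restrict_ext cong_mat refl)
      (simp add: sum.reindex_bij_betw[OF h, of "\<lambda>x. complex_of_real (p x) * F x _ $$ _"])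
  ultimately show ?thesis unfolding conv_channels_def mem_Collect_eq by (intro exI conjI) auto
qed

lemma conjugation_index:
  assumes "U \<in> carrier_mat d d" "X \<in> carrier_mat d d" "i < d" "j < d"
  shows "(U * X * mat_adjoint U) $$ (i, j)
    = (\<Sum>b<d. \<Sum>a<d. U $$ (i, a) * X $$ (a, b) * cnj (U $$ (j, b)))"
proof -
  note adj = mat_adjoint_carrier[OF assms(1)]
  have UX: "U * X \<in> carrier_mat d d" using assms by simp
  have "entry (U * X * mat_adjoint U) i j = (\<Sum>b<d. entry (U * X) i b * entry (mat_adjoint U) b j)"
    by (rule entry_mult[OF UX adj assms(3,4)])
  also have "\<dots> = (\<Sum>b<d. \<Sum>a<d. U $$ (i, a) * X $$ (a, b) * cnj (U $$ (j, b)))"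
  proof (intro sum.cong refl)
    fix b assume b: "b \<in> {..<d}"
    then have "entry (U * X) i b = (\<Sum>a<d. U $$ (i, a) * X $$ (a, b))"
      using entry_mult[OF assms(1-3)] by (simp add: entry_def)
    then show "entry (U * X) i b * entry (mat_adjoint U) b j
        = (\<Sum>a<d. U $$ (i, a) * X $$ (a, b) * cnj (U $$ (j, b)))"
      using b mat_adjoint_index[OF assms(1), of b j] assms(4)
      by (simp add: entry_def sum_distrib_right)
  qed
  finally show ?thesis by (simp only: entry_def)
qed

definition diagonal :: "nat \<Rightarrow> (nat \<Rightarrow> complex) \<Rightarrow> complex mat" where
  "diagonal d \<theta> = mat d d (\<lambda>(i, j). if i = j then \<theta> i else 0)"

lemma diagonal_unitary:
  assumes "\<And>i. i < d \<Longrightarrow> cmod (\<theta> i) = 1"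
  shows "diagonal d \<theta> \<in> unitary_mats d"
proof -
  have D: "diagonal d \<theta> \<in> carrier_mat d d" by (simp add: diagonal_def)
  have adj: "mat_adjoint (diagonal d \<theta>) = diagonal d (\<lambda>i. cnj (\<theta> i))"
  proof (rule eq_matI)
    fix i j assume "i < dim_row (diagonal d (\<lambda>i. cnj (\<theta> i)))" "j < dim_col (diagonal d (\<lambda>i. cnj (\<theta> i)))"
    then have ij: "i < d" "j < d" by (simp_all add: diagonal_def)
    then show "mat_adjoint (diagonal d \<theta>) $$ (i, j) = diagonal d (\<lambda>i. cnj (\<theta> i)) $$ (i, j)"
      unfolding mat_adjoint_index[OF D ij] by (simp add: diagonal_def)
  qed (use mat_adjoint_carrier[OF D] in \<open>auto simp: diagonal_def\<close>)
  have mult: "diagonal d u * diagonal d v = diagonal d (\<lambda>i. u i * v i)" for u v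
    by (intro eq_matI) (auto simp: diagonal_def scalar_prod_def atLeast0LessThan if_distrib
        cong: if_cong)
  have one: "diagonal d (\<lambda>i. \<theta> i * cnj (\<theta> i)) = 1\<^sub>m d" "diagonal d (\<lambda>i. cnj (\<theta> i) * \<theta> i) = 1\<^sub>m d"
    using assms
    by (auto intro!: eq_matI simp: diagonal_def complex_norm_square[symmetric] mult.commute)
  show ?thesis unfolding unitary_mats_def using D adj mult one by simp
qed

lemma diagonal_conjugation_index:
  assumes "X \<in> carrier_mat d d" "i < d" "j < d"
  shows "(diagonal d \<theta> * X * mat_adjoint (diagonal d \<theta>)) $$ (i, j) = \<theta> i * X $$ (i, j) * cnj (\<theta> j)"
proof -
  have D: "diagonal d \<theta> \<in> carrier_mat d d" by (simp add: diagonal_def)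
  have "(diagonal d \<theta> * X * mat_adjoint (diagonal d \<theta>)) $$ (i, j)
      = (\<Sum>b<d. \<Sum>a<d. if a = i then (if b = j then \<theta> i * X $$ (i, j) * cnj (\<theta> j) else 0) else 0)"
    unfolding conjugation_index[OF D assms]
    by (intro sum.cong refl) (use assms in \<open>auto simp: diagonal_def\<close>)
  then show ?thesis using assms by simp
qed

text \<open>Pick \<open>k\<close> with probability \<open>p k\<close> and then, independently in
  each coordinate, one of two phases with mean \<open>z k i\<close>. The mixture of the resulting
  diagonal unitaries is the Schur map: a phase times its own conjugate is 1, and distinct
  coordinates are independent.\<close>

lemma schur_mixed_unitary_of_contractions:
  fixes z :: "nat \<Rightarrow> nat \<Rightarrow> complex"
  assumes p: "\<And>k. k < m \<Longrightarrow> 0 \<le> p k" "(\<Sum>k<m. p k) = (1::real)"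
    and z: "\<And>k i. k < m \<Longrightarrow> i < d \<Longrightarrow> cmod (z k i) \<le> 1"
  shows "schur_map d (mat d d (\<lambda>(i, j). if i = j then 1
      else \<Sum>k<m. of_real (p k) * (z k i * cnj (z k j)))) \<in> schur_mixed_unitary d"
    (is "schur_map d ?S \<in> _")
proof -
  \<comment> \<open>Outside the index range any two phases will do; this makes
    \<open>\<alpha>\<close> and \<open>\<beta>\<close> unimodular everywhere.\<close>
  have "\<exists>a b. cmod a = 1 \<and> cmod b = 1 \<and> (k < m \<and> i < d \<longrightarrow> z k i = (a + b) / 2)" for k i
    using z[of k i] by (metis disc_midpoint_of_circle norm_one)
  then obtain \<alpha> \<beta> where \<alpha>: "\<And>k i. cmod (\<alpha> k i) = 1" and \<beta>: "\<And>k i. cmod (\<beta> k i) = 1"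
    and z_eq: "\<And>k i. k < m \<Longrightarrow> i < d \<Longrightarrow> z k i = (\<alpha> k i + \<beta> k i) / 2"
    by metis
  define G where "G = {..<d} \<rightarrow>\<^sub>E (UNIV :: bool set)"
  define I where "I = {..<m} \<times> G"
  define w where "w x = p (fst x) * (1 / 2) ^ d" for x :: "nat \<times> (nat \<Rightarrow> bool)"
  define \<theta> where "\<theta> x l = (if snd x l then \<alpha> (fst x) l else \<beta> (fst x) l)"
    for x :: "nat \<times> (nat \<Rightarrow> bool)" and l
  have finG: "finite G" unfolding G_def by (intro finite_PiE) auto
  then have finI: "finite I" unfolding I_def by simp
  have w0: "0 \<le> w x" if "x \<in> I" for x
    using that p(1) by (auto simp: I_def w_def)
  have "card G = 2 ^ d" unfolding G_def by (subst card_PiE) simp_all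
  then have "(\<Sum>x\<in>I. w x) = 1"
    unfolding I_def w_def sum.cartesian_product' using p(2)
    by (simp add: sum_distrib_right[symmetric] power_one_over)
  have S: "?S $$ (i, j) = (\<Sum>x\<in>I. of_real (w x) * (\<theta> x i * cnj (\<theta> x j)))" if ij: "i < d" "j < d" for i j
  proof -
    have "(\<Sum>x\<in>I. of_real (w x) * (\<theta> x i * cnj (\<theta> x j)))
        = (\<Sum>k<m. of_real (p k) * (\<Sum>g\<in>G. (1 / 2) ^ d * (\<theta> (k, g) i * cnj (\<theta> (k, g) j))))"
      unfolding I_def w_def sum.cartesian_product' sum_distrib_left by (simp add: mult.assoc)
    also have "\<dots> = (\<Sum>k<m. of_real (p k) * (if i = j then 1 else z k i * cnj (z k j)))"
    proof (intro sum.cong refl arg_cong2[where f = "(*)"])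
      fix k assume "k \<in> {..<m}"
      then show "(\<Sum>g\<in>G. (1 / 2) ^ d * (\<theta> (k, g) i * cnj (\<theta> (k, g) j)))
          = (if i = j then 1 else z k i * cnj (z k j))"
        using independent_phases_second_moment[of d "\<alpha> k" "\<beta> k" "z k" i j] \<alpha> \<beta> z_eq ij
        unfolding G_def \<theta>_def fst_conv snd_conv by simp
    qed
    also have "\<dots> = ?S $$ (i, j)"
      using ij p(2) by (simp add: of_real_sum[symmetric] del: of_real_sum)
    finally show ?thesis by simp
  qed
  \<comment> \<open>The quadratic form of a mixture of rank one matrices \<theta> \<theta>\<dagger>
    is the weighted sum of the squared moduli of the inner products of \<open>u\<close> with
    \<theta>.\<close>
  have "psd d ?S"
    unfolding psd_iff
  proof (intro conjI allI)
    fix u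
    have "inner_n d u (app_n d (entry ?S) u)
        = (\<Sum>i<d. \<Sum>j<d. \<Sum>x\<in>I. of_real (w x) * ((cnj (u i) * \<theta> x i) * (cnj (\<theta> x j) * u j)))"
      unfolding inner_n_app_n entry_def
      by (intro sum.cong refl) (use S in \<open>auto simp: sum_distrib_left sum_distrib_right mult_ac\<close>)
    also have "\<dots> = (\<Sum>i<d. \<Sum>x\<in>I. \<Sum>j<d. of_real (w x) * ((cnj (u i) * \<theta> x i) * (cnj (\<theta> x j) * u j)))"
      by (intro sum.cong refl sum.swap)
    also have "\<dots> = (\<Sum>x\<in>I. \<Sum>i<d. \<Sum>j<d. of_real (w x) * ((cnj (u i) * \<theta> x i) * (cnj (\<theta> x j) * u j)))"
      by (rule sum.swap)
    also have "\<dots> = (\<Sum>x\<in>I. of_real (w x) * (inner_n d u (\<theta> x) * inner_n d (\<theta> x) u))"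
      unfolding inner_n_def sum_product by (simp only: sum_distrib_left)
    also have "\<dots> = (\<Sum>x\<in>I. of_real (w x * (cmod (inner_n d u (\<theta> x)))\<^sup>2))"
      unfolding of_real_mult complex_norm_square inner_n_cnj ..
    also have "0 \<le> \<dots>"
      using w0 by (intro sum_nonneg) (simp add: less_eq_complex_def)
    finally show "0 \<le> inner_n d u (app_n d (entry ?S) u)" .
  qed simp
  then have "schur_map d ?S \<in> schur_channels d"
    unfolding schur_channels_def by (intro CollectI exI[of _ ?S]) simp
  moreover have "schur_map d ?S \<in> conv_channels d (unitary_channels d)"
  proof -
    define F where "F x = (\<lambda>X \<in> carrier_mat d d. diagonal d (\<theta> x) * X * mat_adjoint (diagonal d (\<theta> x)))"
      for x
    have "F x \<in> unitary_channels d" for x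
      unfolding unitary_channels_def F_def using \<alpha> \<beta>
      by (intro CollectI exI[of _ "diagonal d (\<theta> x)"] conjI diagonal_unitary refl) (simp add: \<theta>_def)
    then have "(\<lambda>X \<in> carrier_mat d d.
        mat d d (\<lambda>(i, j). \<Sum>x\<in>I. complex_of_real (w x) * F x X $$ (i, j)))
        \<in> conv_channels d (unitary_channels d)"
      using finI w0 \<open>(\<Sum>x\<in>I. w x) = 1\<close> by (intro conv_channels_finite) auto
    also have "(\<lambda>X \<in> carrier_mat d d.
        mat d d (\<lambda>(i, j). \<Sum>x\<in>I. complex_of_real (w x) * F x X $$ (i, j))) = schur_map d ?S"
      unfolding schur_map_def
    proof (intro restrict_ext cong_mat refl)
      fix X :: "complex mat" and i j assume X: "X \<in> carrier_mat d d" and ij: "i < d" "j < d"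
      have "(\<Sum>x\<in>I. complex_of_real (w x) * F x X $$ (i, j))
          = (\<Sum>x\<in>I. of_real (w x) * (\<theta> x i * cnj (\<theta> x j))) * X $$ (i, j)"
        unfolding F_def restrict_apply'[OF X] diagonal_conjugation_index[OF X ij] sum_distrib_right
        by (simp add: mult_ac)
      then show "(case (i, j) of (i, j) \<Rightarrow> \<Sum>x\<in>I. complex_of_real (w x) * F x X $$ (i, j))
          = (case (i, j) of (i, j) \<Rightarrow> ?S $$ (i, j) * X $$ (i, j))"
        unfolding prod.case S[OF ij] .
    qed
    finally show ?thesis .
  qed
  ultimately show ?thesis unfolding schur_mixed_unitary_def by blast
qed

text \<open>The rows of a unitary matrix are unit vectors.\<close>

lemma unitary_diagonal_le_1:
  assumes "U \<in> unitary_mats d" "i < d"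
  shows "cmod (U $$ (i, i)) \<le> 1"
proof -
  have U: "U \<in> carrier_mat d d" and UU: "U * mat_adjoint U = 1\<^sub>m d"
    using assms(1) by (auto simp: unitary_mats_def)
  have "(U * mat_adjoint U) $$ (i, i) = (\<Sum>j<d. U $$ (i, j) * cnj (U $$ (i, j)))"
    using U assms(2) mat_adjoint_carrier[OF U]
    by (auto simp: scalar_prod_def atLeast0LessThan mat_adjoint_index[OF U] intro!: sum.cong)
  then have "complex_of_real (\<Sum>j<d. (cmod (U $$ (i, j)))\<^sup>2) = of_real 1"
    unfolding UU of_real_sum complex_norm_square using assms(2) by simp
  then have "(\<Sum>j<d. (cmod (U $$ (i, j)))\<^sup>2) = 1" using of_real_eq_iff by blast
  moreover have "(cmod (U $$ (i, i)))\<^sup>2 \<le> (\<Sum>j<d. (cmod (U $$ (i, j)))\<^sup>2)"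
    using assms(2) by (intro member_le_sum) auto
  ultimately show ?thesis by (simp add: power_le_one_iff abs_square_le_1)
qed

subsection \<open>Compression to Schur multipliers\<close>

text \<open>For \<open>V e\<^sub>i = e\<^sub>i \<otimes> e\<^sub>i\<close> the map \<open>X \<mapsto> V\<^sup>\<dagger> (G \<otimes> id)(V X V\<^sup>\<dagger>) V\<close> is the Schur multiplier with entries
  \<open>(G E\<^sub>i\<^sub>j)\<^sub>i\<^sub>j\<close>.  After tensoring with an \<open>n\<close>-dimensional ancilla, \<open>V\<close> sends the basis vector \<open>r\<close> to
  \<open>f r\<close>, where the new ancilla has dimension \<open>d n\<close>.\<close>

lemma tensor_id_off_diagonal_le:
  fixes G L :: op_map
  assumes d: "0 < d" and n: "0 < n" and X: "X \<in> carrier_mat (d * n) (d * n)"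
    and G: "\<And>i j x. i < d \<Longrightarrow> j < d \<Longrightarrow>
      G (mat d d (\<lambda>(a, b). if a = i \<and> b = j then x else 0)) $$ (i, j) = M i j * x"
    and L: "\<And>A i j. A \<in> carrier_mat d d \<Longrightarrow> i < d \<Longrightarrow> j < d \<Longrightarrow>
      L A $$ (i, j) = (if i = j then 0 else M i j * A $$ (i, j))"
  obtains Y where "Y \<in> carrier_mat (d * (d * n)) (d * (d * n))" "trace_norm Y \<le> trace_norm X"
    "trace_norm (tensor_id d n L X) \<le> 2 * trace_norm (tensor_id d (d * n) G Y)"
proof -
  define N where "N = d * n"
  have N: "0 < N" using d n by (simp add: N_def)
  have divd: "r div n < d" if "r < N" for r
    using that n by (simp add: N_def less_mult_imp_div_less)
  \<comment> \<open>The new ancilla has dimension \<open>N = d * n\<close> and stores the whole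
    index \<open>r\<close>, while the first factor keeps \<open>r div n\<close>. So
    \<open>f r\<close> is the index of the corresponding product basis vector.\<close>
  define f where "f r = (r div n) * N + r" for r
  have fdiv: "f r div N = r div n" and fmod: "f r mod N = r" if "r < N" for r
    using that N by (simp_all add: f_def)
  have inj: "inj_on f {..<N}" by (metis fmod inj_onI lessThan_iff)
  have flt: "f r < d * N" if "r < N" for r
  proof -
    have "f r < Suc (r div n) * N" using that by (simp add: f_def)
    also have "\<dots> \<le> d * N" using divd[OF that] by (intro mult_right_mono) auto
    finally show ?thesis .
  qed
  then have ran: "f ` {..<N} \<subseteq> {..<d * N}" by auto
  \<comment> \<open>This is V X V\<dagger>. The equation \<open>r = f (r mod N)\<close> tests
    whether \<open>r\<close> is in the range of \<open>f\<close>, because \<open>f\<close> is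
    inverted there by reduction modulo \<open>N\<close>.\<close>
  define Y where "Y = mat (d * N) (d * N) (\<lambda>(r, c).
    if r = f (r mod N) \<and> c = f (c mod N) then X $$ (r mod N, c mod N) else 0)"
  have Y: "Y \<in> carrier_mat (d * N) (d * N)" by (simp add: Y_def)
  have XN: "X \<in> carrier_mat N N" using X by (simp add: N_def)
  have YX: "trace_norm Y \<le> trace_norm X"
  proof (rule trace_norm_embed_le[OF inj ran XN Y])
    show "Y $$ (f i, f j) = X $$ (i, j)" if "i < N" "j < N" for i j
      using that by (simp add: Y_def flt fmod)
    show "Y $$ (r, c) = 0" if "r < d * N" "c < d * N" "r \<notin> f ` {..<N} \<or> c \<notin> f ` {..<N}" for r c
    proof -
      have "\<not> (r = f (r mod N) \<and> c = f (c mod N))"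
        using that(3) N by (metis imageI lessThan_iff mod_less_divisor)
      then show ?thesis using that(1,2) by (auto simp: Y_def)
    qed
  qed
  define Z where "Z = tensor_id d N G Y"
  have Z: "Z \<in> carrier_mat (d * N) (d * N)" by (simp add: Z_def tensor_id_def)
  \<comment> \<open>The coefficient of \<open>Y\<close> at ancilla position \<open>(r, c)\<close> is
    a multiple of a single matrix unit, and the entry of \<open>Z\<close> that is read sits at the
    position of that same unit. This is exactly what the assumption on \<open>G\<close>
    evaluates.\<close>
  have Zf: "Z $$ (f r, f c) = M (r div n) (c div n) * X $$ (r, c)" if rc: "r < N" "c < N" for r c
  proof -
    have "tensor_coeff d N Y r c
        = mat d d (\<lambda>(a, b). if a = r div n \<and> b = c div n then X $$ (r, c) else 0)"
      unfolding tensor_coeff_def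
    proof (intro cong_mat refl)
      fix a b assume ab: "a < d" "b < d"
      have lt: "a * N + r < d * N" if "a < d" "r < N" for a r
      proof -
        have "a * N + r < Suc a * N" using that by simp
        also have "\<dots> \<le> d * N" using that by (intro mult_right_mono) auto
        finally show ?thesis .
      qed
      show "(case (a, b) of (i, j) \<Rightarrow> Y $$ (i * N + r, j * N + c))
          = (case (a, b) of (a, b) \<Rightarrow> if a = r div n \<and> b = c div n then X $$ (r, c) else 0)"
        using ab rc N lt by (simp add: Y_def f_def)
    qed
    then show ?thesis
      using rc divd by (simp add: Z_def tensor_id_def flt fdiv fmod G)
  qed
  define W where "W = mat N N (\<lambda>(r, c). Z $$ (f r, f c))"
  have W: "W \<in> carrier_mat N N" by (simp add: W_def)
  have WZ: "trace_norm W \<le> trace_norm Z"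
    by (rule trace_norm_submatrix_le[OF inj ran W Z]) (simp add: W_def)
  \<comment> \<open>Group the indices by their first tensor factor \<open>r div n\<close>. As
    \<open>L\<close> kills the diagonal and otherwise multiplies by \<open>M\<close>, its extension
    applied to \<open>X\<close> is \<open>W\<close> without the diagonal blocks.\<close>
  have "trace_norm (tensor_id d n L X) \<le> 2 * trace_norm W"
  proof (rule trace_norm_off_diagonal_blocks_le[OF W])
    show "tensor_id d n L X \<in> carrier_mat N N" by (simp add: tensor_id_def N_def)
    fix r c assume rc: "r < N" "c < N"
    have A: "tensor_coeff d n X (r mod n) (c mod n) \<in> carrier_mat d d"
      by (simp add: tensor_coeff_def)
    have "tensor_coeff d n X (r mod n) (c mod n) $$ (r div n, c div n) = X $$ (r, c)"
      using divd rc by (simp add: tensor_coeff_def)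
    then have "tensor_id d n L X $$ (r, c)
        = (if r div n = c div n then 0 else M (r div n) (c div n) * X $$ (r, c))"
      using rc divd L[OF A, of "r div n" "c div n"] by (simp add: tensor_id_def N_def)
    then show "tensor_id d n L X $$ (r, c) = (if r div n = c div n then 0 else W $$ (r, c))"
      using rc by (simp add: W_def Zf)
  qed
  with WZ have "trace_norm (tensor_id d n L X) \<le> 2 * trace_norm Z" by simp
  then show thesis using that[of Y] Y YX unfolding Z_def N_def by blast
qed

section \<open>From the trace norm to the diamond norm\<close>

lemma trace_norm_0_dim:
  assumes "X \<in> carrier_mat 0 0"
  shows "trace_norm X = 0"
proof -
  obtain w where "pairing 0 w (entry X) = of_real (trace_norm X)"
    by (rule trace_norm_eq_pairing[OF assms])
  then show ?thesis by (simp add: pairing_def)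
qed

lemma trace_norm_le_diamond_norm:
  assumes "0 < n" "X \<in> carrier_mat (d * n) (d * n)" "trace_norm X \<le> 1"
  shows "ereal (trace_norm (tensor_id d n G X)) \<le> diamond_norm d G"
proof -
  have "ereal (trace_norm (tensor_id d n G X)) \<le> induced_trace_norm (d * n) (tensor_id d n G)"
    unfolding induced_trace_norm_def using assms(2,3) by (intro SUP_upper) auto
  also have "\<dots> \<le> diamond_norm d G"
    unfolding diamond_norm_def using assms(1) by (intro SUP_upper) auto
  finally show ?thesis .
qed

text \<open>A test operator for \<open>L\<close> with ancilla dimension \<open>n\<close> becomes one
  for \<open>G\<close> with ancilla dimension \<open>d * n\<close>; the supremum over all ancillas
  in the diamond norm absorbs the enlargement.\<close>

lemma diamond_norm_off_diagonal_le:
  fixes G L :: op_map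
  assumes G: "\<And>i j x. i < d \<Longrightarrow> j < d \<Longrightarrow>
      G (mat d d (\<lambda>(a, b). if a = i \<and> b = j then x else 0)) $$ (i, j) = M i j * x"
    and L: "\<And>A i j. A \<in> carrier_mat d d \<Longrightarrow> i < d \<Longrightarrow> j < d \<Longrightarrow>
      L A $$ (i, j) = (if i = j then 0 else M i j * A $$ (i, j))"
  shows "diamond_norm d L \<le> 2 * diamond_norm d G"
  unfolding diamond_norm_def[of d L] induced_trace_norm_def
proof (intro SUP_least)
  fix n X
  assume "n \<in> {1..}" and X: "X \<in> {X \<in> carrier_mat (d * n) (d * n). trace_norm X \<le> 1}"
  then have n: "0 < n" by auto
  show "ereal (trace_norm (tensor_id d n L X)) \<le> 2 * diamond_norm d G"
  \<comment> \<open>For \<open>d = 0\<close> the enlarged ancilla would have dimension 0, outside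
    the range of the supremum. All operators are then empty and the left side is zero.\<close>
  proof (cases "d = 0")
    case True
    then have "X \<in> carrier_mat 0 0" "tensor_id d n L X \<in> carrier_mat 0 0"
      "tensor_id d n G X \<in> carrier_mat 0 0"
      using X by (auto simp: tensor_id_def)
    then have "ereal (trace_norm (tensor_id d n L X)) = 0" "0 \<le> diamond_norm d G"
      using trace_norm_le_diamond_norm[OF n, of X d G] X
      by (auto simp: trace_norm_0_dim zero_ereal_def)
    then show ?thesis by (simp only:) (rule ereal_0_le_mult, simp_all)
  next
    case False
    obtain Y where Y: "Y \<in> carrier_mat (d * (d * n)) (d * (d * n))" "trace_norm Y \<le> trace_norm X"
      and le: "trace_norm (tensor_id d n L X) \<le> 2 * trace_norm (tensor_id d (d * n) G Y)"
      by (rule tensor_id_off_diagonal_le[where d = d and n = n and X = X and G = G and L = L and M = M])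
        (use False n X G L in auto)
    have "ereal (trace_norm (tensor_id d n L X)) \<le> 2 * ereal (trace_norm (tensor_id d (d * n) G Y))"
      using le by simp
    also have "\<dots> \<le> 2 * diamond_norm d G"
      using False n X Y by (intro ereal_mult_left_mono trace_norm_le_diamond_norm) auto
    finally show ?thesis .
  qed
qed

text \<open>Conjugation by a unitary U maps the matrix unit at \<open>(i, j)\<close> to a matrix
  whose \<open>(i, j)\<close> entry is U_ii times the conjugate of U_jj. Hence \<Psi> compresses to
  the Schur multiplier \<open>T\<close>, whose off-diagonal entries a mixture of diagonal unitaries
  reproduces.\<close>

lemma conv_unitary_channels_to_schur:
  assumes \<Phi>: "\<Phi> \<in> schur_channels d" and \<Psi>: "\<Psi> \<in> conv_channels d (unitary_channels d)"
  obtains \<Lambda> where "\<Lambda> \<in> schur_mixed_unitary d" "channel_dist d \<Phi> \<Lambda> \<le> 2 * channel_dist d \<Phi> \<Psi>"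
proof -
  obtain S where \<Phi>S: "\<Phi> = schur_map d S" and S1: "\<And>i. i < d \<Longrightarrow> S $$ (i, i) = 1"
    using \<Phi> unfolding schur_channels_def by blast
  obtain m :: nat and p F where \<Psi>F: "\<Psi> = (\<lambda>X \<in> carrier_mat d d.
       mat d d (\<lambda>(i, j). \<Sum>k<m. complex_of_real (p k) * F k X $$ (i, j)))"
    and F: "\<forall>k<m. 0 \<le> p k \<and> F k \<in> unitary_channels d" and sum: "(\<Sum>k<m. p k) = 1"
    using \<Psi> unfolding conv_channels_def by blast
  have "\<forall>k. \<exists>U. k < m \<longrightarrow> U \<in> unitary_mats d \<and> F k = (\<lambda>X \<in> carrier_mat d d. U * X * mat_adjoint U)"
    using F unfolding unitary_channels_def by blast
  then obtain U where U: "\<And>k. k < m \<Longrightarrow> U k \<in> unitary_mats d"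
    and FU: "\<And>k. k < m \<Longrightarrow> F k = (\<lambda>X \<in> carrier_mat d d. U k * X * mat_adjoint (U k))"
    by metis
  define T where "T i j = (\<Sum>k<m. of_real (p k) * (U k $$ (i, i) * cnj (U k $$ (j, j))))" for i j
  \<comment> \<open>The diagonal of \<open>T\<close> may fall below 1 and is reset to 1. The
    difference from \<Phi> then vanishes on the diagonal, as the comparison of diamond norms
    demands.\<close>
  define S' where "S' = mat d d (\<lambda>(i, j). if i = j then 1 else T i j)"
  have mixed: "schur_map d S' \<in> schur_mixed_unitary d"
    unfolding S'_def T_def using F sum U
    by (intro schur_mixed_unitary_of_contractions) (auto intro: unitary_diagonal_le_1)
  have "channel_dist d \<Phi> (schur_map d S') \<le> 2 * channel_dist d \<Phi> \<Psi>"
    unfolding channel_dist_def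
  proof (rule diamond_norm_off_diagonal_le[where M = "\<lambda>i j. S $$ (i, j) - T i j"])
    fix i j :: nat and x :: complex assume ij: "i < d" "j < d"
    define E where "E = mat d d (\<lambda>(a, b). if a = i \<and> b = j then x else 0)"
    have E: "E \<in> carrier_mat d d" by (simp add: E_def)
    have "F k E $$ (i, j) = U k $$ (i, i) * x * cnj (U k $$ (j, j))" if "k < m" for k
    proof -
      have Uk: "U k \<in> carrier_mat d d" using U[OF that] by (simp add: unitary_mats_def)
      have "F k E $$ (i, j)
          = (\<Sum>b<d. \<Sum>a<d. if a = i then (if b = j then U k $$ (i, i) * x * cnj (U k $$ (j, j)) else 0) else 0)"
        unfolding FU[OF that] restrict_apply'[OF E] conjugation_index[OF Uk E ij]
        by (intro sum.cong refl) (auto simp: E_def)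
      then show ?thesis using ij by simp
    qed
    then have "\<Psi> E $$ (i, j) = T i j * x"
      using E ij unfolding \<Psi>F T_def by (simp add: sum_distrib_left mult_ac)
    moreover have "\<Phi> E $$ (i, j) = S $$ (i, j) * x"
      using E ij unfolding \<Phi>S schur_map_def by (simp add: E_def)
    moreover have "\<Psi> E \<in> carrier_mat d d"
      using E unfolding \<Psi>F by simp
    ultimately show "(\<Phi> E - \<Psi> E) $$ (i, j) = (S $$ (i, j) - T i j) * x"
      using ij by (simp add: left_diff_distrib)
  next
    fix A :: "complex mat" and i j assume "A \<in> carrier_mat d d" "i < d" "j < d"
    then show "(\<Phi> A - schur_map d S' A) $$ (i, j)
        = (if i = j then 0 else (S $$ (i, j) - T i j) * A $$ (i, j))"
      by (auto simp: \<Phi>S schur_map_def S'_def S1 left_diff_distrib)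
  qed
  with mixed show thesis by (rule that)
qed

theorem theorem3:
  fixes d :: nat and \<Phi> :: op_map
  assumes "\<Phi> \<in> schur_channels d"
  shows "ereal (1 / 2) * set_dist d \<Phi> (schur_mixed_unitary d)
           \<le> set_dist d \<Phi> (conv_channels d (unitary_channels d))
       \<and> set_dist d \<Phi> (conv_channels d (unitary_channels d))
           \<le> set_dist d \<Phi> (schur_mixed_unitary d)"
proof
  show "set_dist d \<Phi> (conv_channels d (unitary_channels d)) \<le> set_dist d \<Phi> (schur_mixed_unitary d)"
    unfolding set_dist_def schur_mixed_unitary_def by (intro INF_superset_mono) auto
  show "ereal (1 / 2) * set_dist d \<Phi> (schur_mixed_unitary d)
      \<le> set_dist d \<Phi> (conv_channels d (unitary_channels d))"
    unfolding set_dist_def[of d \<Phi> "conv_channels d (unitary_channels d)"]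
  proof (intro INF_greatest)
    fix \<Psi> assume "\<Psi> \<in> conv_channels d (unitary_channels d)"
    then obtain \<Lambda> where \<Lambda>: "\<Lambda> \<in> schur_mixed_unitary d"
      and le: "channel_dist d \<Phi> \<Lambda> \<le> 2 * channel_dist d \<Phi> \<Psi>"
      by (rule conv_unitary_channels_to_schur[OF assms])
    have "set_dist d \<Phi> (schur_mixed_unitary d) \<le> channel_dist d \<Phi> \<Lambda>"
      unfolding set_dist_def using \<Lambda> by (rule INF_lower)
    also note le
    finally have "ereal (1 / 2) * set_dist d \<Phi> (schur_mixed_unitary d)
        \<le> ereal (1 / 2) * (2 * channel_dist d \<Phi> \<Psi>)"
      by (intro ereal_mult_left_mono) auto
    \<comment> \<open>In the extended reals the cancellation is checked by cases, since the distance
      is not known here to be finite.\<close>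
    also have "\<dots> = channel_dist d \<Phi> \<Psi>"
      by (cases "channel_dist d \<Phi> \<Psi>") auto
    finally show "ereal (1 / 2) * set_dist d \<Phi> (schur_mixed_unitary d) \<le> channel_dist d \<Phi> \<Psi>" .
  qed
qed

end
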